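(* Let $k,r\ge 0$ be integers with $k+r\ge 2$ and $d=2k+r\ge 3$, let $G$ be the free product of $k$ copies of $\mathbb{Z}$ and $r$ copies of $\mathbb{Z}_2$, with symmetric generating set $S=\{s_1,\dots,s_d\}$, and let $\mathbb{T}_d$ be the (left) Cayley graph of $G$ with respect to $S$ (the $d$-regular infinite tree), rooted at the identity $e$. Let $P$ be an environment distribution on $(\Omega,\mathcal{F})$ such that: (i) $P$ is a product measure on $(\Omega,\mathcal{F})$, i.e. under $P$ the random probability laws $\{\omega(x,\cdot) : x\in \mathbb{T}_d\}$ are independent, and they are identically distributed in the sense that $P\circ\theta_x^{-1}=P$ for all $x\in G$; (ii) $E\left[\,|\log \omega(e,s_i)|\,\right]<\infty$ for all $1\le i\le d$. Let $(X_n)_{n\ge 0}$ be the random walk in the random environment with law $P$, started at $e$. Then the walk is transient $\mathbb{P}^e$-almost surely, that is, $$\mathbb{P}^{e}\left(\lim_{n\to\infty}|X_n|=\infty\right)=1.$$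
   Context: Group and tree. $G$ is the free product of groups $G_1,\dots,G_k$ and $H_1,\dots,H_r$, where $G_i=\langle a_i\rangle\cong\mathbb{Z}$ and $H_j=\langle b_j\rangle\cong\mathbb{Z}_2$ (so $b_j^2=e$). The generating set is $S=\{a_1,\dots,a_k\}\cup\{a_1^{-1},\dots,a_k^{-1}\}\cup\{b_1,\dots,b_r\}$, which is symmetric and has $d=2k+r$ elements, enumerated as $s_1,\dots,s_d$. The left Cayley graph has vertex set $G$ and edge set $\{\{x,y\} : yx^{-1}\in S\}$; it is a $d$-regular infinite tree, denoted $\mathbb{T}_d$, with root the identity $e$. For $x\in\mathbb{T}_d$, $N(x)=\{y\in G : yx^{-1}\in S\}$ is the set of neighbors of $x$ (so $N(e)=S$), and $|x|$ is the length of the unique path from $e$ to $x$ (with $|e|=0$). For $x\in G$, the translation $\theta_x:G\to G$, $\theta_x(y)=yx$, is an automorphism of $\mathbb{T}_d$. Environment. $\mathcal{S}=\mathcal{S}_e$ is a collection of probability measures on the $d$-element set $N(e)=S$, assumed to be a Polish space, with Borel $\sigma$-algebra for which the evaluation maps $p\mapsto p(s)$, $s\in S$, are measurable. For each $x\in\mathbb{T}_d$, $\mathcal{S}_x=\mathcal{S}\circ\theta_x^{-1}$ is the push-forward of $\mathcal{S}$ under $\theta_x$, so an element $\omega(x,\cdot)\in\mathcal{S}_x$ is a probability measure supported on $N(x)$: $\omega(x,y)\ge 0$ for all $y\in \mathbb{T}_d$ and $\sum_{y\in N(x)}\omega(x,y)=1$. The environment space is $\Omega=\prod_{x\in\mathbb{T}_d}\mathcal{S}_x$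 with the product $\sigma$-algebra $\mathcal{F}=\bigotimes_{x\in\mathbb{T}_d}\mathcal{B}_{\mathcal{S}_x}$, where $\mathcal{B}_{\mathcal{S}_x}$ is the Borel $\sigma$-algebra of $\mathcal{S}_x$. An environment is $\omega=\{\omega(x,\cdot) : x\in\mathbb{T}_d\}\in\Omega$. An environment distribution is a probability measure $P$ on $(\Omega,\mathcal{F})$, with expectation $E$. In $P\circ\theta_x^{-1}$, $\theta_x$ acts on $\Omega$ by the induced translation of environments, $(\theta_x\omega)(y,z)=\omega(yx^{-1},zx^{-1})$; together with the product property, the invariance says that the random vectors $(\omega(x,sx))_{s\in S}$, $x\in G$, are i.i.d. Random walk. Given $\omega\in\Omega$, $(X_n)_{n\ge0}$ is the time-homogeneous Markov chain on $\mathbb{T}_d$ with transition probabilities $\mathbf{P}_\omega(X_{n+1}=y\mid X_n=x)=\omega(x,y)$. Its law when started at $x$ (i.e. $X_0=x$), on $(\mathbb{T}_d)^{\mathbb{N}_0}$ with $\mathbb{N}_0=\{0,1,2,\dots\}$ and the $\sigma$-algebra $\mathcal{G}$ generated by cylinder sets, is the quenched law $\mathbf{P}_\omega^x$. The annealed measure $\mathbb{P}^x$ on $\Omega\times(\mathbb{T}_d)^{\mathbb{N}_0}$ is defined by $\mathbb{P}^x(A\times B)=\int_A\mathbf{P}_\omega^x(B)\,P(d\omega)$ for $A\in\mathcal{F}$, $B\in\mathcal{G}$; its marginal on $(\mathbb{T}_d)^{\mathbb{N}_0}$ is also denoted $\mathbb{P}^x$. *)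

theory Defs
  imports "HOL-Probability.Probability" "HOL-Algebra.Elementary_Groups"
begin

subsection \<open>Free products\<close>

definition reduced_words :: "'i set \<Rightarrow> ('i \<Rightarrow> 'a monoid) \<Rightarrow> ('i \<times> 'a) list set" where
  "reduced_words I F =
    {w. set w \<subseteq> (SIGMA i:I. carrier (F i) - {\<one>\<^bsub>F i\<^esub>}) \<and> successively (\<lambda>s t. fst s \<noteq> fst t) w}"

text \<open>Multiplication of a reduced word from the left by a single letter; a letter is a nontrivial
  element of one of the factors.\<close>

definition letter_mult ::
    "('i \<Rightarrow> 'a monoid) \<Rightarrow> 'i \<times> 'a \<Rightarrow> ('i \<times> 'a) list \<Rightarrow> ('i \<times> 'a) list" where
  "letter_mult F s w = (case w of
      [] \<Rightarrow> [s]
    | t # v \<Rightarrow>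
        if fst s = fst t then
          let g = snd s \<otimes>\<^bsub>F (fst s)\<^esub> snd t
          in if g = \<one>\<^bsub>F (fst s)\<^esub> then v else (fst s, g) # v
        else s # w)"

definition free_product :: "'i set \<Rightarrow> ('i \<Rightarrow> 'a monoid) \<Rightarrow> ('i \<times> 'a) list monoid" where
  "free_product I F =
    \<lparr>carrier = reduced_words I F, mult = (\<lambda>u v. foldr (letter_mult F) u v), one = []\<rparr>"

text \<open>The factor \<open>Inl i\<close> is the infinite cyclic group generated by \<open>a\<^sub>i\<close>, and the factor
  \<open>Inr j\<close> is the group of order 2 generated by \<open>b\<^sub>j\<close>; both have \<open>1 :: int\<close> as generator.\<close>

type_synonym vertex = "((nat + nat) \<times> int) list"

definition tree_group :: "nat \<Rightarrow> nat \<Rightarrow> vertex monoid" where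
  "tree_group k r =
    free_product ({1..k} <+> {1..r}) (case_sum (\<lambda>_. integer_group) (\<lambda>_. integer_mod_group 2))"

definition gen_a :: "nat \<Rightarrow> vertex" where
  "gen_a i = [(Inl i, 1)]"

definition gen_b :: "nat \<Rightarrow> vertex" where
  "gen_b j = [(Inr j, 1)]"

definition tree_gens :: "nat \<Rightarrow> nat \<Rightarrow> vertex set" where
  "tree_gens k r =
    gen_a ` {1..k} \<union> (\<lambda>i. inv\<^bsub>tree_group k r\<^esub> (gen_a i)) ` {1..k} \<union> gen_b ` {1..r}"


subsection \<open>The left Cayley graph\<close>

definition cayley_edges :: "'g monoid \<Rightarrow> 'g set \<Rightarrow> 'g set set" where
  "cayley_edges G S = {{x, y} | x y. x \<in> carrier G \<and> y \<in> carrier G \<and> y \<otimes>\<^bsub>G\<^esub> inv\<^bsub>G\<^esub> x \<in> S}"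

text \<open>A path is the list of its vertices, so its length is one less than the length of the list.\<close>

definition is_path :: "'g monoid \<Rightarrow> 'g set \<Rightarrow> 'g \<Rightarrow> 'g \<Rightarrow> 'g list \<Rightarrow> bool" where
  "is_path G S x y p \<longleftrightarrow>
    p \<noteq> [] \<and> hd p = x \<and> last p = y \<and> set p \<subseteq> carrier G \<and> distinct p \<and>
    successively (\<lambda>u v. {u, v} \<in> cayley_edges G S) p"

definition root_dist :: "'g monoid \<Rightarrow> 'g set \<Rightarrow> 'g \<Rightarrow> nat" where
  "root_dist G S x = length (THE p. is_path G S \<one>\<^bsub>G\<^esub> x p) - 1"


subsection \<open>Environments\<close>

definition translate :: "'g monoid \<Rightarrow> 'g \<Rightarrow> 'g \<Rightarrow> 'g" where
  "translate G x y = y \<otimes>\<^bsub>G\<^esub> x"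

definition polish_topology :: "'a topology \<Rightarrow> bool" where
  "polish_topology T \<longleftrightarrow> completely_metrizable_space T \<and> separable_space T"

definition borel_algebra :: "'a topology \<Rightarrow> 'a measure" where
  "borel_algebra T = sigma (topspace T) {U. openin T U}"

text \<open>The collection of admissible laws at the root is the underlying set of the topology \<open>T\<close>.
  A probability measure on the finite set \<open>S\<close> is a \<^typ>\<open>'g pmf\<close> whose support lies in \<open>S\<close>.\<close>

definition law_space :: "'g set \<Rightarrow> 'g pmf topology \<Rightarrow> bool" where
  "law_space S T \<longleftrightarrow>
    topspace T \<subseteq> {p. set_pmf p \<subseteq> S} \<and> polish_topology T \<and>
    (\<forall>s\<in>S. (\<lambda>p. pmf p s) \<in> borel_measurable (borel_algebra T))"

text \<open>The admissible laws at \<open>x\<close> together with the Borel sets of the transported topology.\<close>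

definition laws_at :: "'g monoid \<Rightarrow> 'g pmf topology \<Rightarrow> 'g \<Rightarrow> 'g pmf measure" where
  "laws_at G T x =
    sigma (map_pmf (translate G x) ` topspace T)
      {map_pmf (translate G x) ` U | U. openin T U}"

definition env_space :: "'g monoid \<Rightarrow> 'g pmf topology \<Rightarrow> ('g \<Rightarrow> 'g pmf) measure" where
  "env_space G T = PiM (carrier G) (laws_at G T)"

definition env_distribution ::
    "'g monoid \<Rightarrow> 'g pmf topology \<Rightarrow> ('g \<Rightarrow> 'g pmf) measure \<Rightarrow> bool" where
  "env_distribution G T P \<longleftrightarrow> prob_space P \<and> sets P = sets (env_space G T)"

text \<open>Up to the convention of \<^const>\<open>PiM\<close> that environments are \<^const>\<open>undefined\<close> off the carrier, this
  sends \<open>\<omega>\<close> to the environment with transition probabilities \<open>\<omega>(y x\<^sup>-\<^sup>1, z x\<^sup>-\<^sup>1)\<close> from \<open>y\<close> to \<open>z\<close>.\<close>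

definition translate_env :: "'g monoid \<Rightarrow> 'g \<Rightarrow> ('g \<Rightarrow> 'g pmf) \<Rightarrow> 'g \<Rightarrow> 'g pmf" where
  "translate_env G x \<omega> =
    (\<lambda>y\<in>carrier G. map_pmf (translate G x) (\<omega> (y \<otimes>\<^bsub>G\<^esub> inv\<^bsub>G\<^esub> x)))"

definition iid_environment ::
    "'g monoid \<Rightarrow> 'g pmf topology \<Rightarrow> ('g \<Rightarrow> 'g pmf) measure \<Rightarrow> bool" where
  "iid_environment G T P \<longleftrightarrow>
    prob_space.indep_vars P (laws_at G T) (\<lambda>x \<omega>. \<omega> x) (carrier G) \<and>
    (\<forall>x\<in>carrier G. distr P (env_space G T) (translate_env G x) = P)"

text \<open>The library has \<open>ln 0 = 0\<close>; here the value at 0 has to be infinite.\<close>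

definition abs_log :: "real \<Rightarrow> ennreal" where
  "abs_log t = (if t = 0 then \<infinity> else ennreal \<bar>ln t\<bar>)"


subsection \<open>Random walk in random environment\<close>

definition path_space :: "'g monoid \<Rightarrow> (nat \<Rightarrow> 'g) measure" where
  "path_space G = PiM UNIV (\<lambda>_. count_space (carrier G))"

text \<open>The law of \<open>X\<^sub>n\<close> given the history \<open>h = (X\<^sub>0, \<dots>, X\<^sub>n\<^sub>-\<^sub>1)\<close>.  Restricting to the carrier removes
  only a null set.\<close>

primrec step_kernel ::
    "'g monoid \<Rightarrow> ('g \<Rightarrow> 'g pmf) \<Rightarrow> 'g \<Rightarrow> nat \<Rightarrow> (nat \<Rightarrow> 'g) \<Rightarrow> 'g measure" where
  "step_kernel G \<omega> x 0 h = return (count_space (carrier G)) x"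
| "step_kernel G \<omega> x (Suc n) h = restrict_space (measure_pmf (\<omega> (h n))) (carrier G)"

text \<open>The law on infinite paths obtained from the kernels by the Ionescu-Tulcea theorem.\<close>

definition quenched :: "'g monoid \<Rightarrow> ('g \<Rightarrow> 'g pmf) \<Rightarrow> 'g \<Rightarrow> (nat \<Rightarrow> 'g) measure" where
  "quenched G \<omega> x =
    projective_family.lim UNIV
      (Ionescu_Tulcea.CI (step_kernel G \<omega> x) (\<lambda>_. count_space (carrier G)))
      (\<lambda>_. count_space (carrier G))"

definition annealed ::
    "'g monoid \<Rightarrow> ('g \<Rightarrow> 'g pmf) measure \<Rightarrow> 'g \<Rightarrow> (('g \<Rightarrow> 'g pmf) \<times> (nat \<Rightarrow> 'g)) measure" where
  "annealed G P x =
    P \<bind> (\<lambda>\<omega>. quenched G \<omega> x \<bind> (\<lambda>X. return (P \<Otimes>\<^sub>M path_space G) (\<omega>, X)))"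

end

theory Submission
  imports Defs
begin

text \<open>Let \<open>S\<close> be the generating set and \<open>d \<ge> 3\<close> its size.  For a vertex \<open>x\<close> that is reached from its
  parent through the generator \<open>s\<close>, let \<open>\<beta>(x, s)\<close> be the quenched probability that the walk started at
  \<open>x\<close> never visits the parent.  With \<open>q = \<omega>(x, s\<^sup>-\<^sup>1 x)\<close> and \<open>A = (\<Sum>t \<noteq> s\<^sup>-\<^sup>1. \<omega>(x, t x) \<beta>(t x, t))\<close>, first-step
  analysis gives \<open>\<beta>(x, s) = A / (q + A)\<close>.  The walk is transient because \<open>\<beta>\<close> is almost surely positive at
  every vertex, and this has three parts.

  \<^bold>\<open>\<beta> is not almost surely zero.\<close>  Let \<open>\<beta>\<^sub>n\<close> be the probability of climbing \<open>n\<close> generations above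
  \<open>x\<close> before visiting the parent; it decreases to \<open>\<beta>\<close> and satisfies
  \<open>log \<beta>\<^sub>n\<^sub>+\<^sub>1 - log (1 - \<beta>\<^sub>n\<^sub>+\<^sub>1) = log A\<^sub>n - log q\<close>.  By the inequality of the arithmetic and geometric
  means, \<open>log A\<^sub>n\<close> is at least \<open>log (d - 1)\<close> plus the average over the \<open>d - 1\<close> onward generators of
  \<open>log \<omega>(x, t x) + log \<beta>\<^sub>n(t x, t)\<close>.  Take expectations and sum over \<open>s \<in> S\<close>: since inversion permutes
  \<open>S\<close>, the expectations of \<open>log \<omega>(e, s)\<close> cancel, whatever the drift of the environment, and since
  \<open>\<beta>\<^sub>n\<close> decreases, there remains \<open>d log (d - 1) \<le> (\<Sum>s. E[-log (1 - \<beta>\<^sub>n\<^sub>+\<^sub>1(e, s))])\<close>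
  (\<open>entropy_bound\<close>).  The bound survives in the limit, and its left-hand side is positive
  (\<open>escape_inf_not_AE_0\<close>).

  \<^bold>\<open>Zero-one law.\<close>  Given positive transition probabilities, \<open>\<beta>(x, s)\<close> vanishes exactly if all the
  \<open>\<beta>(t x, t)\<close> vanish.  These depend on the environment in disjoint subtrees, so \<open>q\<^sub>s = P(\<beta>(e, s) = 0)\<close>
  satisfies \<open>q\<^sub>s = (\<Prod>t \<noteq> s\<^sup>-\<^sup>1. q\<^sub>t)\<close>.  As \<open>d \<ge> 3\<close>, a solution of this system in \<open>[0, 1]\<close> is identically
  0 or identically 1 (\<open>product_fixed_point_eq_0\<close>), and the first part excludes 1.

  \<^bold>\<open>Transience.\<close>  The product of \<open>1 - \<beta> / 2\<close> along the path from the root to \<open>x\<close> is a bounded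
  function of \<open>x\<close> that is strictly superharmonic at every vertex
  (\<open>return_weight_strictly_superharmonic\<close>).  Hence every vertex has a finite expected number of
  visits, and the walk leaves every ball.\<close>


section \<open>Free products are groups\<close>

lemma reduced_words_Nil [simp]: "[] \<in> reduced_words I F"
  by (simp add: reduced_words_def)

lemma reduced_words_Cons:
  "(i, g) # w \<in> reduced_words I F \<longleftrightarrow>
     i \<in> I \<and> g \<in> carrier (F i) \<and> g \<noteq> \<one>\<^bsub>F i\<^esub> \<and> w \<in> reduced_words I F \<and> (w = [] \<or> fst (hd w) \<noteq> i)"
  by (auto simp: reduced_words_def successively_Cons)

locale group_family =
  fixes I :: "'i set" and F :: "'i \<Rightarrow> 'a monoid"
  assumes factor_group: "i \<in> I \<Longrightarrow> group (F i)"
begin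

lemma letter_mult_closed:
  assumes "i \<in> I" "g \<in> carrier (F i)" "g \<noteq> \<one>\<^bsub>F i\<^esub>" "w \<in> reduced_words I F"
  shows "letter_mult F (i, g) w \<in> reduced_words I F"
proof (cases w)
  case (Cons t v)
  obtain j h where t: "t = (j, h)" by (cases t)
  interpret group "F i" using factor_group[OF assms(1)] .
  have "g \<otimes>\<^bsub>F j\<^esub> h \<in> carrier (F j)" if "i = j" "h \<in> carrier (F j)"
    using m_closed[OF assms(2), of h] that by simp
  then show ?thesis
    using assms Cons t
    by (auto simp: letter_mult_def reduced_words_Cons Let_def)
qed (use assms in \<open>auto simp: letter_mult_def reduced_words_Cons\<close>)

text \<open>Each factor acts on the reduced words by left multiplication.  Associativity of the free product
  follows from this action, as in the argument of van der Waerden.\<close>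

lemma letter_mult_letter_mult:
  assumes "i \<in> I" "g \<in> carrier (F i)" "g \<noteq> \<one>\<^bsub>F i\<^esub>" "h \<in> carrier (F i)" "h \<noteq> \<one>\<^bsub>F i\<^esub>"
    and "w \<in> reduced_words I F"
  shows "letter_mult F (i, g) (letter_mult F (i, h) w) =
    (if g \<otimes>\<^bsub>F i\<^esub> h = \<one>\<^bsub>F i\<^esub> then w else letter_mult F (i, g \<otimes>\<^bsub>F i\<^esub> h) w)"
proof -
  interpret group "F i" using factor_group[OF assms(1)] .
  show ?thesis
  proof (cases "w = [] \<or> fst (hd w) \<noteq> i")
    case True
    then show ?thesis by (cases w) (auto simp: letter_mult_def)
  next
    case False
    then obtain l v where w: "w = (i, l) # v" by (cases w) auto
    have l: "l \<in> carrier (F i)" "l \<noteq> \<one>\<^bsub>F i\<^esub>" and v: "v = [] \<or> fst (hd v) \<noteq> i"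
      using assms(6) by (auto simp: w reduced_words_Cons)
    have assoc: "g \<otimes>\<^bsub>F i\<^esub> (h \<otimes>\<^bsub>F i\<^esub> l) = g \<otimes>\<^bsub>F i\<^esub> h \<otimes>\<^bsub>F i\<^esub> l"
      using assms l by (simp add: m_assoc)
    have gh: "g \<otimes>\<^bsub>F i\<^esub> h \<in> carrier (F i)" using assms by simp
    consider "h \<otimes>\<^bsub>F i\<^esub> l = \<one>\<^bsub>F i\<^esub>" | "g \<otimes>\<^bsub>F i\<^esub> h = \<one>\<^bsub>F i\<^esub>" "h \<otimes>\<^bsub>F i\<^esub> l \<noteq> \<one>\<^bsub>F i\<^esub>"
      | "g \<otimes>\<^bsub>F i\<^esub> h \<noteq> \<one>\<^bsub>F i\<^esub>" "h \<otimes>\<^bsub>F i\<^esub> l \<noteq> \<one>\<^bsub>F i\<^esub>" by blast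
    then show ?thesis
    proof cases
      case 1
      have "g \<otimes>\<^bsub>F i\<^esub> h \<otimes>\<^bsub>F i\<^esub> l = g" using assoc 1 assms by simp
      moreover have "l = g" if "g \<otimes>\<^bsub>F i\<^esub> h = \<one>\<^bsub>F i\<^esub>"
        using calculation that l by simp
      ultimately show ?thesis
        using 1 v assms by (cases v) (auto simp: w letter_mult_def)
    next
      case 2
      then show ?thesis using assoc l by (auto simp: w letter_mult_def)
    next
      case 3
      then show ?thesis using assoc l by (auto simp: w letter_mult_def Let_def)
    qed
  qed
qed

lemma foldr_letter_mult_closed:
  assumes "v \<in> reduced_words I F" "w \<in> reduced_words I F"
  shows "foldr (letter_mult F) v w \<in> reduced_words I F"
  using assms
proof (induction v)
  case (Cons s v)
  then show ?case
    by (cases s) (auto simp: reduced_words_Cons intro!: letter_mult_closed)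
qed simp

lemma foldr_letter_mult_letter_mult:
  assumes "i \<in> I" "g \<in> carrier (F i)" "g \<noteq> \<one>\<^bsub>F i\<^esub>" "v \<in> reduced_words I F" "w \<in> reduced_words I F"
  shows "foldr (letter_mult F) (letter_mult F (i, g) v) w =
    letter_mult F (i, g) (foldr (letter_mult F) v w)"
proof (cases "v = [] \<or> fst (hd v) \<noteq> i")
  case True
  then show ?thesis by (cases v) (auto simp: letter_mult_def)
next
  case False
  then obtain l v' where v: "v = (i, l) # v'" by (cases v) auto
  then have *: "l \<in> carrier (F i)" "l \<noteq> \<one>\<^bsub>F i\<^esub>" "foldr (letter_mult F) v' w \<in> reduced_words I F"
    using assms by (auto simp: reduced_words_Cons intro!: foldr_letter_mult_closed)
  have "foldr (letter_mult F) (letter_mult F (i, g) v) w =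
    (if g \<otimes>\<^bsub>F i\<^esub> l = \<one>\<^bsub>F i\<^esub> then foldr (letter_mult F) v' w
     else letter_mult F (i, g \<otimes>\<^bsub>F i\<^esub> l) (foldr (letter_mult F) v' w))"
    by (simp add: v letter_mult_def[of F _ "(i, l) # v'"] Let_def)
  then show ?thesis
    using letter_mult_letter_mult[OF assms(1-3) *] by (simp add: v)
qed

lemma foldr_letter_mult_foldr:
  assumes "u \<in> reduced_words I F" "v \<in> reduced_words I F" "w \<in> reduced_words I F"
  shows "foldr (letter_mult F) (foldr (letter_mult F) u v) w =
    foldr (letter_mult F) u (foldr (letter_mult F) v w)"
  using assms
proof (induction u)
  case (Cons s u)
  then show ?case
    by (cases s) (auto simp: reduced_words_Cons foldr_letter_mult_letter_mult foldr_letter_mult_closed)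
qed simp

lemma reduced_word_left_inverse:
  assumes "w \<in> reduced_words I F"
  shows "\<exists>v\<in>reduced_words I F. foldr (letter_mult F) v w = []"
  using assms
proof (induction w)
  case (Cons s w)
  obtain i g where s: "s = (i, g)" by (cases s)
  have i: "i \<in> I" "g \<in> carrier (F i)" "g \<noteq> \<one>\<^bsub>F i\<^esub>" and w: "w \<in> reduced_words I F"
    using Cons.prems by (auto simp: s reduced_words_Cons)
  interpret group "F i" using factor_group[OF i(1)] .
  obtain v where v: "v \<in> reduced_words I F" "foldr (letter_mult F) v w = []"
    using Cons.IH w by blast
  let ?t = "[(i, inv\<^bsub>F i\<^esub> g)]"
  have t: "?t \<in> reduced_words I F" using i by (auto simp: reduced_words_Cons)
  have "foldr (letter_mult F) (foldr (letter_mult F) v ?t) (s # w)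
      = foldr (letter_mult F) v (foldr (letter_mult F) ?t (s # w))"
    using Cons.prems v t by (intro foldr_letter_mult_foldr)
  also have "foldr (letter_mult F) ?t (s # w) = w"
    using i by (simp add: s letter_mult_def)
  finally show ?case
    using v t foldr_letter_mult_closed by auto
qed (auto intro!: bexI[of _ "[]"])

lemma group_free_product: "group (free_product I F)"
proof (rule groupI)
  fix x assume "x \<in> carrier (free_product I F)"
  then show "\<exists>y\<in>carrier (free_product I F). y \<otimes>\<^bsub>free_product I F\<^esub> x = \<one>\<^bsub>free_product I F\<^esub>"
    using reduced_word_left_inverse by (auto simp: free_product_def)
qed (auto simp: free_product_def foldr_letter_mult_closed foldr_letter_mult_foldr)

end


section \<open>Groups whose Cayley graph is a tree\<close>

text \<open>A generating set has a tree as its left Cayley graph if every element has a unique shortest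
  spelling and multiplication by a generator from the left either prepends it or cancels the first
  letter.  Here \<open>first x\<close> is the first letter of \<open>x\<close>, that is, the last step of the path from the root to
  \<open>x\<close>.\<close>

locale tree_gen_group = group G for G :: "'g monoid" (structure) +
  fixes S :: "'g set" and len :: "'g \<Rightarrow> nat" and first :: "'g \<Rightarrow> 'g"
  assumes S_subset: "S \<subseteq> carrier G"
    and S_inv: "s \<in> S \<Longrightarrow> inv s \<in> S"
    and S_finite: "finite S"
    and S_card: "card S \<ge> 3"
    and len_eq_0_iff: "x \<in> carrier G \<Longrightarrow> len x = 0 \<longleftrightarrow> x = \<one>"
    and first_in_S: "x \<in> carrier G \<Longrightarrow> x \<noteq> \<one> \<Longrightarrow> first x \<in> S"
    and first_mult: "s \<in> S \<Longrightarrow> x \<in> carrier G \<Longrightarrow> x = \<one> \<or> s \<noteq> inv (first x) \<Longrightarrow> first (s \<otimes> x) = s"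
    and len_mult: "s \<in> S \<Longrightarrow> x \<in> carrier G \<Longrightarrow> x = \<one> \<or> s \<noteq> inv (first x) \<Longrightarrow> len (s \<otimes> x) = Suc (len x)"
    and len_parent: "x \<in> carrier G \<Longrightarrow> x \<noteq> \<one> \<Longrightarrow> len x = Suc (len (inv (first x) \<otimes> x))"
begin

definition parent :: "'g \<Rightarrow> 'g" where
  "parent x = inv (first x) \<otimes> x"

text \<open>At a vertex whose first letter is \<open>s\<close>, these generators lead away from the root.\<close>

abbreviation onward :: "'g \<Rightarrow> 'g set" where
  "onward s \<equiv> S - {inv s}"

lemma S_carrier [simp, intro]: "s \<in> S \<Longrightarrow> s \<in> carrier G"
  using S_subset by auto

lemma len_one [simp]: "len \<one> = 0"
  using len_eq_0_iff by simp

lemma one_notin_S: "\<one> \<notin> S"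
  using len_mult[of \<one> \<one>] by auto

lemma first_closed [simp]: "x \<in> carrier G \<Longrightarrow> x \<noteq> \<one> \<Longrightarrow> first x \<in> carrier G"
  using first_in_S by auto

lemma parent_closed [simp]: "x \<in> carrier G \<Longrightarrow> x \<noteq> \<one> \<Longrightarrow> parent x \<in> carrier G"
  by (simp add: parent_def)

lemma first_mult_parent: "x \<in> carrier G \<Longrightarrow> x \<noteq> \<one> \<Longrightarrow> first x \<otimes> parent x = x"
  by (simp add: parent_def m_assoc[symmetric])

lemma first_gen: "s \<in> S \<Longrightarrow> first s = s"
  using first_mult[of s \<one>] by simp

lemma parent_mult:
  assumes "s \<in> S" "x \<in> carrier G" "x = \<one> \<or> s \<noteq> inv (first x)"
  shows "parent (s \<otimes> x) = x"
  using assms by (simp add: parent_def first_mult m_assoc[symmetric])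

lemma mult_neq_one:
  assumes "s \<in> S" "x \<in> carrier G" "x = \<one> \<or> s \<noteq> inv (first x)"
  shows "s \<otimes> x \<noteq> \<one>"
  using len_mult[OF assms] by auto

lemma first_neq_inv_first_parent:
  assumes "x \<in> carrier G" "x \<noteq> \<one>" 
  shows "parent x = \<one> \<or> first x \<noteq> inv (first (parent x))"
proof (rule ccontr)
  assume a: "\<not> ?thesis"
  have *: "parent x \<in> carrier G" using assms by simp
  have "len (parent x) = Suc (len (first x \<otimes> parent x))"
    using len_parent[OF *] a by auto
  then have "len (parent x) = Suc (len x)"
    by (simp only: first_mult_parent[OF assms])
  moreover have "len x = Suc (len (parent x))"
    using len_parent[OF assms] by (simp only: parent_def)
  ultimately show False by linarith
qed

lemma card_onward: "s \<in> S \<Longrightarrow> Suc (card (onward s)) = card S"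
  using card.remove[OF S_finite S_inv] by simp

lemma onward_nonempty: "s \<in> S \<Longrightarrow> onward s \<noteq> {}"
proof
  assume "s \<in> S" "onward s = {}"
  then have "Suc 0 = card S" using card_onward[of s] by (simp only: card.empty)
  then show False using S_card by simp
qed

lemma inv_S_iff: "x \<in> carrier G \<Longrightarrow> inv x \<in> S \<longleftrightarrow> x \<in> S"
  using S_inv by (metis inv_inv)

lemma sum_S_split: "s \<in> S \<Longrightarrow> (\<Sum>t\<in>S. f t) = f (inv s) + (\<Sum>t\<in>onward s. (f t :: 'b :: comm_monoid_add))"
  by (rule sum.remove[OF S_finite S_inv])

lemma finite_balls: "finite {x \<in> carrier G. len x \<le> n}"
proof (induction n)
  case 0
  have "{x \<in> carrier G. len x \<le> 0} \<subseteq> {\<one>}" using len_eq_0_iff by auto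
  then show ?case using finite_subset by blast
next
  case (Suc n)
  let ?B = "{x \<in> carrier G. len x \<le> n}"
  have "{x \<in> carrier G. len x \<le> Suc n} \<subseteq> insert \<one> ((\<lambda>(s, x). s \<otimes> x) ` (S \<times> ?B))"
  proof
    fix x assume x: "x \<in> {x \<in> carrier G. len x \<le> Suc n}"
    show "x \<in> insert \<one> ((\<lambda>(s, x). s \<otimes> x) ` (S \<times> ?B))"
    proof (cases "x = \<one>")
      case False
      then have "parent x \<in> ?B"
        using x len_parent[of x] by (auto simp: parent_def[symmetric])
      then show ?thesis
        using False x first_mult_parent[of x] first_in_S[of x]
        by (auto intro!: image_eqI[of _ _ "(first x, parent x)"])
    qed simp
  qed
  then show ?case
    using Suc S_finite by (meson finite_SigmaI finite_imageI finite_insert finite_subset)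
qed

lemma countable_carrier: "countable (carrier G)"
proof -
  have *: "carrier G = (\<Union>n. {x \<in> carrier G. len x \<le> n})" by auto
  show ?thesis
    by (subst *) (intro countable_UN countableI_type countable_finite finite_balls)
qed

subsection \<open>The distance from the root\<close>

lemma cayley_edges_iff:
  assumes "x \<in> carrier G" "y \<in> carrier G"
  shows "{x, y} \<in> cayley_edges G S \<longleftrightarrow> y \<otimes> inv x \<in> S"
proof -
  have "y \<otimes> inv x \<in> S \<longleftrightarrow> x \<otimes> inv y \<in> S"
    using inv_S_iff[of "y \<otimes> inv x"] assms by (simp add: inv_mult_group)
  then show ?thesis
    using assms by (auto simp: cayley_edges_def doubleton_eq_iff)
qed

lemma parent_edge: "x \<in> carrier G \<Longrightarrow> x \<noteq> \<one> \<Longrightarrow> {parent x, x} \<in> cayley_edges G S"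
  using first_in_S[of x] by (simp add: cayley_edges_iff parent_def inv_mult_group m_assoc[symmetric])

lemma edge_parent_or_child:
  assumes "x \<in> carrier G" "y \<in> carrier G" "{x, y} \<in> cayley_edges G S"
  shows "(x \<noteq> \<one> \<and> y = parent x) \<or> (y \<noteq> \<one> \<and> x = parent y \<and> len y = Suc (len x))"
proof -
  let ?s = "y \<otimes> inv x"
  have s: "?s \<in> S" and y: "y = ?s \<otimes> x" using assms by (auto simp: cayley_edges_iff m_assoc)
  show ?thesis
  proof (cases "x = \<one> \<or> ?s \<noteq> inv (first x)")
    case True
    then show ?thesis
      using parent_mult[OF s assms(1)] len_mult[OF s assms(1)] mult_neq_one[OF s assms(1)] y by metis
  next
    case False
    then show ?thesis using y by (metis parent_def)
  qed
qed

text \<open>The vertices of a path are distinct, so a path that starts at the root can never step down: it would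
  return to the vertex it came from.  So the path to a vertex is found by iterating \<^term>\<open>parent\<close> from its end.\<close>

lemma path_climbs:
  assumes p: "is_path G S \<one> x p" and "i < length p"
  shows "len (p ! i) = i \<and> (i > 0 \<longrightarrow> p ! (i - 1) = parent (p ! i))"
  using assms(2)
proof (induction i rule: less_induct)
  case (less i)
  have c: "p ! j \<in> carrier G" if "j < length p" for j
    using p nth_mem[OF that] by (auto simp: is_path_def)
  show ?case
  proof (cases i)
    case 0
    then show ?thesis using p less.prems by (auto simp: is_path_def hd_conv_nth)
  next
    case (Suc j)
    have e: "{p ! j, p ! i} \<in> cayley_edges G S"
      using p less.prems Suc by (auto simp: is_path_def successively_conv_nth)
    have IH: "len (p ! j) = j" "j > 0 \<Longrightarrow> p ! (j - 1) = parent (p ! j)"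
      using less.IH[of j] less.prems Suc by auto
    (* Stepping down would revisit the vertex from which p ! j was reached. *)
    have "\<not> (p ! j \<noteq> \<one> \<and> p ! i = parent (p ! j))"
    proof
      assume a: "p ! j \<noteq> \<one> \<and> p ! i = parent (p ! j)"
      then have "j > 0" using IH(1) len_eq_0_iff[of "p ! j"] c[of j] less.prems Suc by auto
      then have "p ! i = p ! (j - 1)" using IH a by simp
      then show False
        using p less.prems Suc by (auto simp: is_path_def nth_eq_iff_index_eq)
    qed
    then show ?thesis
      using edge_parent_or_child[OF c c e] less.prems Suc IH(1) by auto
  qed
qed

lemma path_exists: "x \<in> carrier G \<Longrightarrow> \<exists>p. is_path G S \<one> x p \<and> (\<forall>y\<in>set p. len y \<le> len x)"
proof (induction "len x" arbitrary: x)
  case 0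
  then show ?case by (intro exI[of _ "[\<one>]"]) (auto simp: is_path_def len_eq_0_iff)
next
  case (Suc n)
  then have x: "x \<noteq> \<one>" by auto
  have l: "len (parent x) = n" using len_parent[OF Suc.prems x] Suc.hyps by (simp add: parent_def)
  obtain p where p: "is_path G S \<one> (parent x) p" "\<forall>y\<in>set p. len y \<le> n"
    using Suc.hyps(1)[of "parent x"] Suc.prems x l by auto
  have "x \<notin> set p" using p(2) Suc.hyps(2) by auto
  then have "is_path G S \<one> x (p @ [x])"
    using p(1) Suc.prems parent_edge[OF Suc.prems x] by (auto simp: is_path_def successively_append_iff)
  moreover have "\<forall>y\<in>set (p @ [x]). len y \<le> len x"
    using p(2) Suc.hyps(2) by auto
  ultimately show ?case by blast
qed

lemma root_dist_eq_len:
  assumes x: "x \<in> carrier G"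
  shows "root_dist G S x = len x"
proof -
  have length: "length p = Suc (len x)" and last: "p ! len x = x" if "is_path G S \<one> x p" for p
  proof -
    have p: "p \<noteq> []" "p ! (length p - 1) = x" using that by (auto simp: is_path_def last_conv_nth)
    then have "len x = length p - 1" using path_climbs[OF that, of "length p - 1"] by simp
    then show "length p = Suc (len x)" "p ! len x = x" using p by (cases p; simp)+
  qed
  have unique: "p = q" if "is_path G S \<one> x p" "is_path G S \<one> x q" for p q
  proof (rule nth_equalityI)
    show "length p = length q" using length that by simp
    have "p ! (len x - j) = q ! (len x - j)" for j
    proof (induction j)
      case 0
      then show ?case using last that by simp
    next
      case (Suc j)
      show ?case
      proof (cases "len x - j = 0")
        case False
        then have "len x - Suc j = len x - j - 1" by simp
        then show ?thesis
          using path_climbs[OF that(1), of "len x - j"] path_climbs[OF that(2), of "len x - j"]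
            length[OF that(1)] length[OF that(2)] False Suc by simp
      qed (use Suc in simp)
    qed
    then show "p ! i = q ! i" if "i < length p" for i
      using length[OF \<open>is_path G S \<one> x p\<close>] that by (metis diff_diff_cancel less_Suc_eq_le)
  qed
  obtain p where "is_path G S \<one> x p" using path_exists[OF x] by blast
  then show ?thesis
    using length unique unfolding root_dist_def by (subst the_equality) auto
qed

subsection \<open>The subtrees above the root\<close>

text \<open>The neighbour of the root on the path from the root to \<open>x\<close>: the descent stops one step before the
  root.\<close>

definition branch :: "'g \<Rightarrow> 'g" where
  "branch x = (parent ^^ (len x - 1)) x"

definition subtree :: "'g \<Rightarrow> 'g set" where
  "subtree t = {x \<in> carrier G. x \<noteq> \<one> \<and> branch x = t}"

lemma gen_in_subtree: "t \<in> S \<Longrightarrow> t \<in> subtree t"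
  using len_mult[of t \<one>] one_notin_S by (auto simp: subtree_def branch_def)

lemma mult_in_subtree:
  assumes "x \<in> subtree t" "s \<in> onward (first x)"
  shows "s \<otimes> x \<in> subtree t"
proof -
  have x: "x \<in> carrier G" "x \<noteq> \<one>" "branch x = t" and s: "s \<in> S" "s \<noteq> inv (first x)"
    using assms by (auto simp: subtree_def)
  obtain n where n: "len x = Suc n" using x len_eq_0_iff[of x] by (cases "len x") auto
  have "branch (s \<otimes> x) = (parent ^^ n) (parent (s \<otimes> x))"
    using s x n by (simp add: branch_def len_mult funpow_swap1)
  also have "\<dots> = t" using s x n by (simp add: parent_mult branch_def)
  finally show ?thesis
    using s x mult_neq_one by (simp add: subtree_def)
qed

lemma disjoint_subtrees: "disjoint_family_on subtree S"
  by (auto simp: disjoint_family_on_def subtree_def)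

end


section \<open>The free product of copies of the infinite cyclic group and the group of order two\<close>

text \<open>A letter \<open>(Inl i, n)\<close> abbreviates \<open>\<bar>n\<bar>\<close> equal generators, and a letter \<open>(Inr j, 1)\<close> is itself a
  generator.\<close>

definition word_len :: "vertex \<Rightarrow> nat" where
  "word_len w = (\<Sum>l\<leftarrow>w. nat \<bar>snd l\<bar>)"

definition word_first :: "vertex \<Rightarrow> vertex" where
  "word_first w = [(fst (hd w), sgn (snd (hd w)))]"

abbreviation factors :: "nat + nat \<Rightarrow> int monoid" where
  "factors \<equiv> case_sum (\<lambda>_. integer_group) (\<lambda>_. integer_mod_group 2)"

lemma group_family_factors: "group_family I factors"
  unfolding group_family_def by (auto split: sum.split)

lemma group_tree_group: "group (tree_group k r)"
  unfolding tree_group_def by (rule group_family.group_free_product[OF group_family_factors])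

lemma one_tree_group: "\<one>\<^bsub>tree_group k r\<^esub> = []"
  by (simp add: tree_group_def free_product_def)

lemma Nil_in_tree_group: "[] \<in> carrier (tree_group k r)"
  by (simp add: tree_group_def free_product_def)

lemma Inl_Cons_in_tree_group:
  "(Inl i, n) # w \<in> carrier (tree_group k r) \<longleftrightarrow>
     i \<in> {1..k} \<and> n \<noteq> 0 \<and> w \<in> carrier (tree_group k r) \<and> (w = [] \<or> fst (hd w) \<noteq> Inl i)"
  by (auto simp: tree_group_def free_product_def reduced_words_Cons)

lemma Inr_Cons_in_tree_group:
  "(Inr j, n) # w \<in> carrier (tree_group k r) \<longleftrightarrow>
     j \<in> {1..r} \<and> n = 1 \<and> w \<in> carrier (tree_group k r) \<and> (w = [] \<or> fst (hd w) \<noteq> Inr j)"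
  by (auto simp: tree_group_def free_product_def reduced_words_Cons carrier_integer_mod_group)

lemmas tree_group_words = Nil_in_tree_group Inl_Cons_in_tree_group Inr_Cons_in_tree_group

lemma mult_letter_tree_group: "[s] \<otimes>\<^bsub>tree_group k r\<^esub> w = letter_mult factors s w"
  by (simp add: tree_group_def free_product_def)

lemma inv_Inl:
  assumes "i \<in> {1..k}" "n \<noteq> 0"
  shows "inv\<^bsub>tree_group k r\<^esub> [(Inl i, n)] = [(Inl i, - n)]"
  using assms by (intro group.inv_equality[OF group_tree_group])
    (auto simp: mult_letter_tree_group letter_mult_def one_tree_group tree_group_words)

lemma inv_Inr:
  assumes "j \<in> {1..r}"
  shows "inv\<^bsub>tree_group k r\<^esub> [(Inr j, 1)] = [(Inr j, 1)]"
  using assms by (intro group.inv_equality[OF group_tree_group])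
    (auto simp: mult_letter_tree_group letter_mult_def one_tree_group tree_group_words)

lemma tree_gens_eq:
  "tree_gens k r = (\<lambda>i. [(Inl i, 1)]) ` {1..k} \<union> (\<lambda>i. [(Inl i, - 1)]) ` {1..k} \<union> (\<lambda>j. [(Inr j, 1)]) ` {1..r}"
proof -
  have "(\<lambda>i. inv\<^bsub>tree_group k r\<^esub> (gen_a i)) ` {1..k} = (\<lambda>i. [(Inl i, - 1)]) ` {1..k}"
    by (rule image_cong) (auto simp: gen_a_def inv_Inl)
  then show ?thesis by (simp add: tree_gens_def gen_a_def gen_b_def)
qed

lemma card_tree_gens: "card (tree_gens k r) = 2 * k + r"
  unfolding tree_gens_eq
  by (subst card_Un_disjoint; force?)+ (simp add: card_image inj_on_def)

lemma tree_gen_group_tree_group: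
  assumes "2 * k + r \<ge> 3"
  shows "tree_gen_group (tree_group k r) (tree_gens k r) word_len word_first"
proof -
  interpret G: group "tree_group k r" by (rule group_tree_group)
  let ?G = "tree_group k r"
  have Cons: "thesis" if "x \<in> carrier ?G" "x \<noteq> \<one>\<^bsub>?G\<^esub>"
    "\<And>i n w. x = (Inl i, n) # w \<Longrightarrow> thesis" "\<And>j w. x = (Inr j, 1) # w \<Longrightarrow> thesis" for x thesis
  proof (cases x)
    case (Cons l w)
    then show thesis using that by (cases l; cases "fst l") (auto simp: tree_group_words)
  qed (use that one_tree_group in auto)
  show ?thesis
  proof
    show "tree_gens k r \<subseteq> carrier ?G"
      by (auto simp: tree_gens_eq tree_group_words)
    show "inv\<^bsub>?G\<^esub> s \<in> tree_gens k r" if "s \<in> tree_gens k r" for s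
      using that by (auto simp: tree_gens_eq inv_Inl inv_Inr)
    show "finite (tree_gens k r)"
      by (simp add: tree_gens_eq)
    show "3 \<le> card (tree_gens k r)"
      using assms by (simp add: card_tree_gens)
    fix x assume x: "x \<in> carrier ?G"
    show "word_len x = 0 \<longleftrightarrow> x = \<one>\<^bsub>?G\<^esub>"
    proof (cases "x = \<one>\<^bsub>?G\<^esub>")
      case False
      then show ?thesis
        by (rule Cons[OF x]) (use x in \<open>auto simp: word_len_def tree_group_words one_tree_group\<close>)
    qed (simp add: one_tree_group word_len_def)
    show "word_first x \<in> tree_gens k r" "word_len x = Suc (word_len (inv\<^bsub>?G\<^esub> word_first x \<otimes>\<^bsub>?G\<^esub> x))"
      if "x \<noteq> \<one>\<^bsub>?G\<^esub>"
    proof -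
      show "word_first x \<in> tree_gens k r"
        by (rule Cons[OF x that])
          (use x in \<open>auto simp: word_first_def tree_group_words tree_gens_eq sgn_if image_iff\<close>)
      show "word_len x = Suc (word_len (inv\<^bsub>?G\<^esub> word_first x \<otimes>\<^bsub>?G\<^esub> x))"
        by (rule Cons[OF x that])
          (use x in \<open>auto simp: word_first_def word_len_def tree_group_words inv_Inl inv_Inr
            mult_letter_tree_group letter_mult_def sgn_if Let_def\<close>)
    qed
    fix s assume s: "s \<in> tree_gens k r" and *: "x = \<one>\<^bsub>?G\<^esub> \<or> s \<noteq> inv\<^bsub>?G\<^esub> (word_first x)"
    show "word_first (s \<otimes>\<^bsub>?G\<^esub> x) = s" "word_len (s \<otimes>\<^bsub>?G\<^esub> x) = Suc (word_len x)"
    proof -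
      have "word_first (s \<otimes>\<^bsub>?G\<^esub> x) = s \<and> word_len (s \<otimes>\<^bsub>?G\<^esub> x) = Suc (word_len x)"
      proof (cases "x = \<one>\<^bsub>?G\<^esub>")
        case True
        then show ?thesis
          using s by (auto simp: tree_gens_eq one_tree_group mult_letter_tree_group letter_mult_def
              word_first_def word_len_def)
      next
        case False
        then show ?thesis
          by (rule Cons[OF x])
            (use x s * False in \<open>auto simp: tree_gens_eq one_tree_group mult_letter_tree_group letter_mult_def
              word_first_def word_len_def tree_group_words inv_Inl inv_Inr Let_def sgn_if split: if_splits\<close>)
      qed
      then show "word_first (s \<otimes>\<^bsub>?G\<^esub> x) = s" "word_len (s \<otimes>\<^bsub>?G\<^esub> x) = Suc (word_len x)" by auto
    qed
  qed
qed


section \<open>The random walk in a fixed environment\<close>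

lemma prob_space_restrict_pmf:
  assumes "set_pmf p \<subseteq> V"
  shows "prob_space (restrict_space (measure_pmf p) V)"
proof (rule prob_space_restrict_space)
  show "emeasure (measure_pmf p) V = 1"
    using assms by (intro measure_pmf.emeasure_eq_1_AE) (auto simp: AE_measure_pmf_iff)
qed simp

lemma sets_restrict_pmf: "sets (restrict_space (measure_pmf p) V) = sets (count_space V)"
  by (auto simp: sets_restrict_space)

lemma nn_integral_restrict_pmf:
  assumes "set_pmf p \<subseteq> V"
  shows "(\<integral>\<^sup>+ y. f y \<partial>restrict_space (measure_pmf p) V) = (\<integral>\<^sup>+ y. f y \<partial>measure_pmf p)"
  using assms
  by (auto simp: nn_integral_restrict_space AE_measure_pmf_iff intro!: nn_integral_cong_AE split: split_indicator)

lemma step_kernel_0: "step_kernel G \<omega> x 0 = (\<lambda>_. return (count_space (carrier G)) x)"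
  by (rule ext) simp

locale walk_in_environment =
  fixes G :: "'g monoid" and \<omega> :: "'g \<Rightarrow> 'g pmf" and x0 :: 'g
  assumes supp: "x \<in> carrier G \<Longrightarrow> set_pmf (\<omega> x) \<subseteq> carrier G"
    and start: "x0 \<in> carrier G"
begin

lemma step_kernel_measurable:
  "step_kernel G \<omega> x0 n \<in> Pi\<^sub>M {0..<n} (\<lambda>_. count_space (carrier G)) \<rightarrow>\<^sub>M subprob_algebra (count_space (carrier G))"
proof (cases n)
  case 0
  then show ?thesis
    using start unfolding 0 step_kernel_0
    by (intro measurable_const measurable_space[OF return_measurable]) simp
next
  case (Suc m)
  have "(\<lambda>y. restrict_space (measure_pmf (\<omega> y)) (carrier G)) \<in> count_space (carrier G) \<rightarrow>\<^sub>M subprob_algebra (count_space (carrier G))"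
    using prob_space_restrict_pmf[OF supp, THEN prob_space_imp_subprob_space]
    by (auto simp: space_subprob_algebra sets_restrict_pmf)
  then show ?thesis
    unfolding Suc step_kernel.simps
    by (rule measurable_compose[OF measurable_component_singleton, rotated]) simp
qed

lemma prob_space_step_kernel:
  assumes h: "h \<in> space (Pi\<^sub>M {0..<n} (\<lambda>_. count_space (carrier G)))"
  shows "prob_space (step_kernel G \<omega> x0 n h)"
proof (cases n)
  case 0
  then show ?thesis using start by (auto intro!: prob_space_return)
next
  case (Suc m)
  then show ?thesis
    using h by (auto simp: space_PiM intro!: prob_space_restrict_pmf supp)
qed

sublocale IT: Ionescu_Tulcea "step_kernel G \<omega> x0" "\<lambda>_. count_space (carrier G)"
  by (intro Ionescu_Tulcea.intro step_kernel_measurable prob_space_step_kernel)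

abbreviation "Q \<equiv> quenched G \<omega> x0"

lemma quenched_eq_lim: "Q = IT.PF.lim"
  by (simp add: quenched_def)

lemma sets_quenched [measurable_cong]: "sets Q = sets (path_space G)"
  by (simp add: quenched_eq_lim path_space_def)

lemma space_quenched: "space Q = space (path_space G)"
  by (rule sets_eq_imp_space_eq[OF sets_quenched])

lemma prob_space_quenched: "prob_space Q"
proof (rule prob_space_distrD)
  show "(\<lambda>X. restrict X {}) \<in> Q \<rightarrow>\<^sub>M PiM {} (\<lambda>_. count_space (carrier G))"
    by (auto simp: quenched_eq_lim measurable_cong_sets[OF IT.PF.sets_lim refl] intro!: measurable_restrict)
  show "prob_space (distr Q (PiM {} (\<lambda>_. count_space (carrier G))) (\<lambda>X. restrict X {}))"
    unfolding quenched_eq_lim by (subst IT.distr_lim) (auto intro: IT.PF.prob_space_P)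
qed

lemma coordinate_measurable [measurable]: "(\<lambda>X. X n) \<in> Q \<rightarrow>\<^sub>M count_space (carrier G)"
  unfolding measurable_cong_sets[OF sets_quenched refl] path_space_def by measurable

lemma measurable_fun_coordinate [measurable]: "(\<lambda>X. f (X n)) \<in> borel_measurable Q"
  for f :: "'g \<Rightarrow> ennreal"
  by (rule measurable_compose[OF coordinate_measurable]) simp

text \<open>The marginals of the walk are computed on finitely many steps, where the law is an iterated
  composition of kernels.\<close>

lemma nn_integral_coordinate_C:
  fixes f :: "'g \<Rightarrow> ennreal"
  shows "(\<integral>\<^sup>+ X. f (X n) \<partial>Q) = (\<integral>\<^sup>+ h. f (h n) \<partial>IT.C 0 (Suc n) (\<lambda>_. undefined))"
proof -
  let ?J = "{0..<Suc n}" and ?M = "\<lambda>_. count_space (carrier G)"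
  have [measurable]: "(\<lambda>h. f (h n)) \<in> borel_measurable (PiM ?J ?M)"
    by (rule measurable_compose[OF measurable_component_singleton]) auto
  have "IT.up_to ?J = Suc n"
    using IT.up_to_iff_Ico[of ?J "Suc n"] IT.up_to_less[of ?J n] by simp
  then have CI: "IT.CI ?J = distr (IT.C 0 (Suc n) (\<lambda>_. undefined)) (PiM ?J ?M) (\<lambda>h. restrict h ?J)"
    by (simp add: IT.CI_def)
  have [measurable]: "(\<lambda>h. restrict h ?J) \<in> IT.C 0 (Suc n) (\<lambda>_. undefined) \<rightarrow>\<^sub>M PiM ?J ?M"
    by (subst measurable_cong_sets[OF IT.sets_C refl]) (auto intro!: measurable_restrict)
  have [measurable]: "(\<lambda>h. restrict h ?J) \<in> Q \<rightarrow>\<^sub>M PiM ?J ?M"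
    by (auto simp: quenched_eq_lim measurable_cong_sets[OF IT.PF.sets_lim refl] intro!: measurable_restrict)
  have "(\<integral>\<^sup>+ X. f (X n) \<partial>Q) = (\<integral>\<^sup>+ h. f (h n) \<partial>distr Q (PiM ?J ?M) (\<lambda>X. restrict X ?J))"
    by (subst nn_integral_distr) auto
  also have "\<dots> = (\<integral>\<^sup>+ h. f (h n) \<partial>IT.CI ?J)"
    unfolding quenched_eq_lim by (subst IT.distr_lim) auto
  also have "\<dots> = (\<integral>\<^sup>+ h. f (h n) \<partial>IT.C 0 (Suc n) (\<lambda>_. undefined))"
    unfolding CI by (subst nn_integral_distr) (auto simp del: IT.C.simps)
  finally show ?thesis .
qed

lemma nn_integral_C_Suc:
  fixes f :: "'g \<Rightarrow> ennreal"
  shows "(\<integral>\<^sup>+ h. f (h n) \<partial>IT.C 0 (Suc n) (\<lambda>_. undefined)) =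
    (\<integral>\<^sup>+ h. (\<integral>\<^sup>+ y. f y \<partial>step_kernel G \<omega> x0 n h) \<partial>IT.C 0 n (\<lambda>_. undefined))"
proof -
  let ?M = "\<lambda>_. count_space (carrier G)"
  have m: "(\<lambda>h. f (h n)) \<in> borel_measurable (PiM {0..<Suc n} ?M)"
    by (rule measurable_compose[OF measurable_component_singleton]) auto
  have "(\<integral>\<^sup>+ h. f (h n) \<partial>IT.C 0 (Suc n) (\<lambda>_. undefined)) =
    (\<integral>\<^sup>+ h. (\<integral>\<^sup>+ h'. f (h' n) \<partial>IT.eP n h) \<partial>IT.C 0 n (\<lambda>_. undefined))"
    using IT.measurable_eP[of n]
    by (simp, subst nn_integral_bind[OF m]) (auto simp: measurable_cong_sets[OF IT.sets_C refl])
  also have "\<dots> = (\<integral>\<^sup>+ h. (\<integral>\<^sup>+ y. f y \<partial>step_kernel G \<omega> x0 n h) \<partial>IT.C 0 n (\<lambda>_. undefined))"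
    by (rule nn_integral_cong) (auto simp: IT.space_C IT.nn_integral_eP[OF _ m])
  finally show ?thesis .
qed

lemma nn_integral_coordinate_0: "(\<integral>\<^sup>+ X. f (X 0) \<partial>Q) = f x0" for f :: "'g \<Rightarrow> ennreal"
  unfolding nn_integral_coordinate_C nn_integral_C_Suc step_kernel_0
  using start prob_space.emeasure_space_1[OF IT.prob_space_C[of "\<lambda>_. undefined" 0 0]]
  by (simp add: nn_integral_return space_PiM del: IT.C.simps)

text \<open>The Markov property in the weak form that the Green function needs: the laws of the single
  \<open>X\<^sub>n\<close> evolve by the transition operator.\<close>

lemma nn_integral_coordinate_Suc:
  "(\<integral>\<^sup>+ X. f (X (Suc n)) \<partial>Q) = (\<integral>\<^sup>+ X. (\<integral>\<^sup>+ y. f y \<partial>measure_pmf (\<omega> (X n))) \<partial>Q)"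
  for f :: "'g \<Rightarrow> ennreal"
proof -
  have "(\<integral>\<^sup>+ X. f (X (Suc n)) \<partial>Q) =
    (\<integral>\<^sup>+ h. (\<integral>\<^sup>+ y. f y \<partial>measure_pmf (\<omega> (h n))) \<partial>IT.C 0 (Suc n) (\<lambda>_. undefined))"
    unfolding nn_integral_coordinate_C nn_integral_C_Suc[where n="Suc n"]
    by (rule nn_integral_cong)
      (auto simp: IT.space_C space_PiM simp del: IT.C.simps intro!: nn_integral_restrict_pmf supp)
  then show ?thesis
    by (simp only: nn_integral_coordinate_C[where f="\<lambda>x. \<integral>\<^sup>+ y. f y \<partial>measure_pmf (\<omega> x)"])
qed

text \<open>Along the walk, the expectation of \<open>u\<close> starts at \<open>u x0\<close>, stays nonnegative, and each visit to \<open>v\<close>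
  lowers it by \<open>g v\<close> or more.  So the expected number of visits is at most \<open>u x0 / g v\<close>.\<close>

lemma strictly_superharmonic_finitely_many_visits:
  fixes u :: "'g \<Rightarrow> ennreal"
  assumes u: "u x0 < \<infinity>"
    and super: "\<And>x. x \<in> carrier G \<Longrightarrow> (\<integral>\<^sup>+ y. u y \<partial>measure_pmf (\<omega> x)) + g x \<le> u x"
    and g: "g v > 0"
  shows "AE X in Q. finite {n. X n = v}"
proof -
  interpret prob_space Q by (rule prob_space_quenched)
  have *: "(\<integral>\<^sup>+ X. u (X N) \<partial>Q) + (\<Sum>n<N. \<integral>\<^sup>+ X. g (X n) \<partial>Q) \<le> u x0" for N
  proof (induction N)
    case 0
    then show ?case by (simp add: nn_integral_coordinate_0)
  next
    case (Suc N)
    have "(\<integral>\<^sup>+ X. u (X (Suc N)) \<partial>Q) + (\<integral>\<^sup>+ X. g (X N) \<partial>Q) =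
        (\<integral>\<^sup>+ X. (\<integral>\<^sup>+ y. u y \<partial>measure_pmf (\<omega> (X N))) + g (X N) \<partial>Q)"
      by (simp add: nn_integral_coordinate_Suc nn_integral_add)
    also have "\<dots> \<le> (\<integral>\<^sup>+ X. u (X N) \<partial>Q)"
      by (rule nn_integral_mono) (auto simp: space_quenched path_space_def space_PiM intro!: super)
    finally have step: "(\<integral>\<^sup>+ X. u (X (Suc N)) \<partial>Q) + (\<integral>\<^sup>+ X. g (X N) \<partial>Q) \<le> (\<integral>\<^sup>+ X. u (X N) \<partial>Q)" .
    have "(\<integral>\<^sup>+ X. u (X (Suc N)) \<partial>Q) + (\<Sum>n<Suc N. \<integral>\<^sup>+ X. g (X n) \<partial>Q) =
        (\<integral>\<^sup>+ X. u (X (Suc N)) \<partial>Q) + (\<integral>\<^sup>+ X. g (X N) \<partial>Q) + (\<Sum>n<N. \<integral>\<^sup>+ X. g (X n) \<partial>Q)"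
      by (simp add: ac_simps)
    also have "\<dots> \<le> (\<integral>\<^sup>+ X. u (X N) \<partial>Q) + (\<Sum>n<N. \<integral>\<^sup>+ X. g (X n) \<partial>Q)"
      by (rule add_right_mono[OF step])
    also have "\<dots> \<le> u x0" by (rule Suc)
    finally show ?case .
  qed
  have "(\<integral>\<^sup>+ X. (\<Sum>n. g (X n)) \<partial>Q) = (\<Sum>n. \<integral>\<^sup>+ X. g (X n) \<partial>Q)"
    by (rule nn_integral_suminf) simp
  also have "\<dots> \<le> u x0"
  proof (rule suminf_le_const)
    show "(\<Sum>n<N. \<integral>\<^sup>+ X. g (X n) \<partial>Q) \<le> u x0" for N
      by (rule order_trans[OF _ *[of N]]) simp
  qed simp
  finally have "(\<integral>\<^sup>+ X. (\<Sum>n. g (X n)) \<partial>Q) \<noteq> \<infinity>" using u by auto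
  then have "AE X in Q. (\<Sum>n. g (X n)) \<noteq> \<infinity>"
    by (intro nn_integral_PInf_AE) auto
  then show ?thesis
  proof (rule AE_mp, intro AE_I2 impI)
    fix X assume fin: "(\<Sum>n. g (X n)) \<noteq> \<infinity>"
    show "finite {n. X n = v}"
    proof (rule ccontr)
      assume inf: "infinite {n. X n = v}"
      have "\<infinity> = (\<integral>\<^sup>+ n. g v \<partial>count_space {n. X n = v})"
        using inf g by (simp add: ennreal_mult_top)
      also have "\<dots> \<le> (\<integral>\<^sup>+ n. g (X n) \<partial>count_space UNIV)"
        by (subst nn_integral_count_space_indicator)
           (auto intro!: nn_integral_mono split: split_indicator)
      also have "\<dots> = (\<Sum>n. g (X n))" by (rule nn_integral_count_space_nat)
      finally show False using fin by (simp add: top_unique)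
    qed
  qed
qed

end

text \<open>On a countable set, the sigma-algebra of kernels is determined by the point masses.\<close>

lemma measurable_restrict_pmf:
  assumes V: "countable V"
    and supp: "\<And>\<omega>. \<omega> \<in> space M \<Longrightarrow> set_pmf (p \<omega>) \<subseteq> V"
    and meas: "\<And>y. y \<in> V \<Longrightarrow> (\<lambda>\<omega>. pmf (p \<omega>) y) \<in> borel_measurable M"
  shows "(\<lambda>\<omega>. restrict_space (measure_pmf (p \<omega>)) V) \<in> M \<rightarrow>\<^sub>M subprob_algebra (count_space V)"
proof (rule measurable_subprob_algebra_generated[where \<Omega>=V and G="insert {} ((\<lambda>y. {y}) ` V)"])
  have "sigma_sets V (insert {} ((\<lambda>y. {y}) ` V)) = Pow V"
  proof (rule antisym)
    show "sigma_sets V (insert {} ((\<lambda>y. {y}) ` V)) \<subseteq> Pow V"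
      using sigma_sets_into_sp[of "insert {} ((\<lambda>y. {y}) ` V)" V] by auto
    have "Pow V = sigma_sets V ((\<lambda>y. {y}) ` V)"
      using sigma_sets_singletons[OF V] by simp
    also have "\<dots> \<subseteq> sigma_sets V (insert {} ((\<lambda>y. {y}) ` V))"
      by (rule sigma_sets_mono') auto
    finally show "Pow V \<subseteq> sigma_sets V (insert {} ((\<lambda>y. {y}) ` V))" .
  qed
  then show "sets (count_space V) = sigma_sets V (insert {} ((\<lambda>y. {y}) ` V))" by simp
  show "Int_stable (insert {} ((\<lambda>y. {y}) ` V))" by (auto simp: Int_stable_def)
  show "subprob_space (restrict_space (measure_pmf (p \<omega>)) V)" if "\<omega> \<in> space M" for \<omega>
    by (intro prob_space_imp_subprob_space prob_space_restrict_pmf supp that)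
  fix A assume "A \<in> insert {} ((\<lambda>y. {y}) ` V)"
  then show "(\<lambda>\<omega>. emeasure (restrict_space (measure_pmf (p \<omega>)) V) A) \<in> borel_measurable M"
    using meas by (auto simp: emeasure_restrict_space emeasure_pmf_single)
next
  have "emeasure (restrict_space (measure_pmf (p \<omega>)) V) V = 1" if "\<omega> \<in> space M" for \<omega>
    using prob_space.emeasure_space_1[OF prob_space_restrict_pmf[OF supp[OF that]]]
    by (simp add: space_restrict_space)
  then show "(\<lambda>\<omega>. emeasure (restrict_space (measure_pmf (p \<omega>)) V) V) \<in> borel_measurable M"
    by (subst measurable_cong) auto
qed (auto simp: sets_restrict_pmf)

text \<open>Needed for the annealed law, since the monadic bind is a mixture of laws only for measurable
  kernels.  It is enough to look at cylinder sets, on which measurability propagates through the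
  compositions of kernels of the Ionescu-Tulcea construction.\<close>

lemma measurable_quenched:
  fixes G :: "'g monoid"
  assumes V: "countable (carrier G)" and x0: "x0 \<in> carrier G"
    and supp: "\<And>\<omega> x. \<omega> \<in> space M \<Longrightarrow> x \<in> carrier G \<Longrightarrow> set_pmf (\<omega> x) \<subseteq> carrier G"
    and meas: "\<And>x y. x \<in> carrier G \<Longrightarrow> y \<in> carrier G \<Longrightarrow> (\<lambda>\<omega>. pmf (\<omega> x) y) \<in> borel_measurable M"
  shows "(\<lambda>\<omega>. quenched G \<omega> x0) \<in> M \<rightarrow>\<^sub>M subprob_algebra (path_space G)"
proof -
  let ?V = "count_space (carrier G)"
  let ?C = "\<lambda>\<omega> n. Ionescu_Tulcea.C (step_kernel G \<omega> x0) (\<lambda>_. ?V) 0 n (\<lambda>_. undefined)"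
  have W: "walk_in_environment G \<omega> x0" if "\<omega> \<in> space M" for \<omega>
    using supp that x0 by unfold_locales auto
  have IT: "Ionescu_Tulcea (step_kernel G \<omega> x0) (\<lambda>_. ?V)" if "\<omega> \<in> space M" for \<omega>
  proof -
    interpret walk_in_environment G \<omega> x0 using W[OF that] .
    show ?thesis by (rule IT.Ionescu_Tulcea_axioms)
  qed
  have step: "(\<lambda>(\<omega>, h). step_kernel G \<omega> x0 n h) \<in> M \<Otimes>\<^sub>M PiM {0..<n} (\<lambda>_. ?V) \<rightarrow>\<^sub>M subprob_algebra ?V" for n
  proof (cases n)
    case 0
    then show ?thesis
      using x0 unfolding 0 step_kernel_0 split_beta'
      by (intro measurable_const measurable_space[OF return_measurable]) simp
  next
    case (Suc m)
    have "(\<lambda>z. restrict_space (measure_pmf (fst z (snd z m))) (carrier G))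
      \<in> M \<Otimes>\<^sub>M PiM {0..<n} (\<lambda>_. ?V) \<rightarrow>\<^sub>M subprob_algebra ?V"
    proof (rule measurable_compose_countable'[OF _ _ V, where g="\<lambda>z. snd z m" and
          f="\<lambda>x z. restrict_space (measure_pmf (fst z x)) (carrier G)"])
      fix x assume "x \<in> carrier G"
      then show "(\<lambda>z. restrict_space (measure_pmf (fst z x)) (carrier G))
        \<in> M \<Otimes>\<^sub>M PiM {0..<n} (\<lambda>_. ?V) \<rightarrow>\<^sub>M subprob_algebra ?V"
        using supp meas
        by (intro measurable_compose[OF measurable_fst] measurable_restrict_pmf[OF V, where p="\<lambda>\<omega>. \<omega> x"]) auto
    next
      show "(\<lambda>z. snd z m) \<in> M \<Otimes>\<^sub>M PiM {0..<n} (\<lambda>_. ?V) \<rightarrow>\<^sub>M ?V"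
        using Suc by (intro measurable_compose[OF measurable_snd measurable_component_singleton]) auto
    qed
    then show ?thesis
      by (simp add: Suc split_beta')
  qed
  have C: "(\<lambda>\<omega>. ?C \<omega> n) \<in> M \<rightarrow>\<^sub>M subprob_algebra (PiM {0..<n} (\<lambda>_. ?V))" for n
  proof (induction n)
    case 0
    have "(\<lambda>_. return (PiM {0..<0} (\<lambda>_. ?V)) (\<lambda>_. undefined)) \<in> M \<rightarrow>\<^sub>M subprob_algebra (PiM {0..<0::nat} (\<lambda>_. ?V))"
      by (intro measurable_const measurable_space[OF return_measurable]) (simp add: space_PiM)
    then show ?case
      by (subst measurable_cong[OF Ionescu_Tulcea.C.simps(1)[OF IT]]) auto
  next
    case (Suc n)
    have "(\<lambda>z. distr (case z of (\<omega>, h) \<Rightarrow> step_kernel G \<omega> x0 n h) (PiM {0..<Suc n} (\<lambda>_. ?V)) (\<lambda>y. (snd z)(n := y)))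
      \<in> M \<Otimes>\<^sub>M PiM {0..<n} (\<lambda>_. ?V) \<rightarrow>\<^sub>M subprob_algebra (PiM {0..<Suc n} (\<lambda>_. ?V))"
      by (rule measurable_distr2[OF _ step])
         (auto intro!: measurable_fun_upd[where J="{0..<n}"] simp: measurable_split_conv)
    then have "(\<lambda>\<omega>. ?C \<omega> n \<bind> (\<lambda>h. distr (step_kernel G \<omega> x0 n h) (PiM {0..<Suc n} (\<lambda>_. ?V)) (fun_upd h n)))
      \<in> M \<rightarrow>\<^sub>M subprob_algebra (PiM {0..<Suc n} (\<lambda>_. ?V))"
      by (intro measurable_bind[OF Suc]) (simp add: split_beta')
    moreover have "?C \<omega> (Suc n) =
        ?C \<omega> n \<bind> (\<lambda>h. distr (step_kernel G \<omega> x0 n h) (PiM {0..<Suc n} (\<lambda>_. ?V)) (fun_upd h n))"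
      if "\<omega> \<in> space M" for \<omega>
    proof -
      have eP: "Ionescu_Tulcea.eP (step_kernel G \<omega> x0) (\<lambda>_. ?V) n =
        (\<lambda>h. distr (step_kernel G \<omega> x0 n h) (PiM {0..<Suc n} (\<lambda>_. ?V)) (fun_upd h n))"
        by (rule ext) (rule Ionescu_Tulcea.eP_def[OF IT[OF that]])
      show ?thesis
        by (subst Ionescu_Tulcea.C.simps(2)[OF IT[OF that]]) (simp add: eP)
    qed
    ultimately show ?case
      by (subst measurable_cong) auto
  qed
  show ?thesis
  proof (rule measurable_subprob_algebra_generated[where
        \<Omega>="\<Pi>\<^sub>E i\<in>(UNIV :: nat set). space ?V" and G="prod_algebra (UNIV :: nat set) (\<lambda>_. ?V)"])
    show "sets (path_space G) = sigma_sets (\<Pi>\<^sub>E i\<in>(UNIV :: nat set). space ?V) (prod_algebra (UNIV :: nat set) (\<lambda>_. ?V))"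
      unfolding path_space_def by (rule sets_PiM)
    show "Int_stable (prod_algebra (UNIV :: nat set) (\<lambda>_. ?V))" by (rule Int_stable_prod_algebra)
    show "prod_algebra (UNIV :: nat set) (\<lambda>_. ?V) \<subseteq> Pow (\<Pi>\<^sub>E i\<in>(UNIV :: nat set). space ?V)" by (rule prod_algebra_sets_into_space)
    show "subprob_space (quenched G \<omega> x0)" "sets (quenched G \<omega> x0) = sets (path_space G)" if "\<omega> \<in> space M" for \<omega>
      using walk_in_environment.prob_space_quenched[OF W[OF that]] walk_in_environment.sets_quenched[OF W[OF that]]
      by (auto intro: prob_space_imp_subprob_space)
    have "emeasure (quenched G \<omega> x0) (\<Pi>\<^sub>E i\<in>(UNIV :: nat set). space ?V) = 1" if "\<omega> \<in> space M" for \<omega>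
      using prob_space.emeasure_space_1[OF walk_in_environment.prob_space_quenched[OF W[OF that]]]
      by (simp add: walk_in_environment.space_quenched[OF W[OF that]] path_space_def space_PiM)
    then show "(\<lambda>\<omega>. emeasure (quenched G \<omega> x0) (\<Pi>\<^sub>E i\<in>(UNIV :: nat set). space ?V)) \<in> borel_measurable M"
      by (subst measurable_cong) auto
    fix A assume "A \<in> prod_algebra (UNIV :: nat set) (\<lambda>_. ?V)"
    then obtain J E where A: "A = prod_emb UNIV (\<lambda>_. ?V) J (Pi\<^sub>E J E)" and J: "finite J"
      and E: "\<And>i. i \<in> J \<Longrightarrow> E i \<in> sets ?V" by (rule prod_algebraE) blast
    obtain n where n: "J \<subseteq> {0..<n}" using J by (metis finite_nat_iff_bounded atLeast0LessThan)
    have X: "Pi\<^sub>E J E \<in> sets (PiM J (\<lambda>_. ?V))" using J E by (intro sets_PiM_I_finite) auto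
    let ?B = "prod_emb {0..<n} (\<lambda>_. ?V) J (Pi\<^sub>E J E)"
    have "emeasure (quenched G \<omega> x0) A = emeasure (?C \<omega> n) ?B" if "\<omega> \<in> space M" for \<omega>
      unfolding quenched_def A
      using Ionescu_Tulcea.lim[OF IT[OF that] J X] Ionescu_Tulcea.emeasure_CI[OF IT[OF that] n X] by simp
    moreover have "(\<lambda>\<omega>. emeasure (?C \<omega> n) ?B) \<in> borel_measurable M"
      using n by (intro measurable_emeasure_subprob_algebra[OF measurable_prod_emb[OF n X], THEN measurable_compose[OF C]])
    ultimately show "(\<lambda>\<omega>. emeasure (quenched G \<omega> x0) A) \<in> borel_measurable M"
      by (subst measurable_cong) auto
  qed
qed


section \<open>Escape probabilities of a nearest-neighbour environment\<close>

context tree_gen_group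
begin

abbreviation rate :: "('g \<Rightarrow> 'g pmf) \<Rightarrow> 'g \<Rightarrow> 'g \<Rightarrow> real" where
  "rate \<omega> x s \<equiv> pmf (\<omega> x) (s \<otimes> x)"

definition nearest_neighbour :: "('g \<Rightarrow> 'g pmf) \<Rightarrow> bool" where
  "nearest_neighbour \<omega> \<longleftrightarrow> (\<forall>x\<in>carrier G. set_pmf (\<omega> x) \<subseteq> (\<lambda>s. s \<otimes> x) ` S)"

definition elliptic :: "('g \<Rightarrow> 'g pmf) \<Rightarrow> bool" where
  "elliptic \<omega> \<longleftrightarrow> nearest_neighbour \<omega> \<and> (\<forall>x\<in>carrier G. \<forall>s\<in>S. rate \<omega> x s > 0)"

text \<open>If \<open>x\<close> is reached from its parent through \<open>s\<close>, this is the probability that the walk started at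
  \<open>x\<close> climbs \<open>n\<close> generations above \<open>x\<close> before it visits the parent.  The recursion is first-step analysis
  solved for the unknown probability.\<close>

primrec escape :: "nat \<Rightarrow> ('g \<Rightarrow> 'g pmf) \<Rightarrow> 'g \<Rightarrow> 'g \<Rightarrow> real" where
  "escape 0 \<omega> x s = 1"
| "escape (Suc n) \<omega> x s =
    (\<Sum>t\<in>onward s. rate \<omega> x t * escape n \<omega> (t \<otimes> x) t) /
    (rate \<omega> x (inv s) + (\<Sum>t\<in>onward s. rate \<omega> x t * escape n \<omega> (t \<otimes> x) t))"

text \<open>The probability that the walk started at \<open>x\<close> never visits the parent of \<open>x\<close>.\<close>

definition escape_inf :: "('g \<Rightarrow> 'g pmf) \<Rightarrow> 'g \<Rightarrow> 'g \<Rightarrow> real" where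
  "escape_inf \<omega> x s = (INF n. escape n \<omega> x s)"

lemma inj_mult_right: "x \<in> carrier G \<Longrightarrow> inj_on (\<lambda>s. s \<otimes> x) S"
  using S_subset by (auto simp: inj_on_def)

lemma nearest_neighbourD:
  assumes "nearest_neighbour \<omega>" "x \<in> carrier G"
  shows "set_pmf (\<omega> x) \<subseteq> carrier G"
  using assms by (force simp: nearest_neighbour_def)

lemma sum_rate:
  assumes "nearest_neighbour \<omega>" "x \<in> carrier G"
  shows "(\<Sum>s\<in>S. rate \<omega> x s) = 1"
proof -
  have "(\<Sum>s\<in>S. rate \<omega> x s) = (\<Sum>y\<in>(\<lambda>s. s \<otimes> x) ` S. pmf (\<omega> x) y)"
    using inj_mult_right[OF assms(2)] by (simp add: sum.reindex)
  also have "\<dots> = 1"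
    using assms S_finite by (intro sum_pmf_eq_1) (auto simp: nearest_neighbour_def)
  finally show ?thesis .
qed

lemma nn_integral_nearest_neighbour:
  fixes f :: "'g \<Rightarrow> ennreal"
  assumes "nearest_neighbour \<omega>" "x \<in> carrier G"
  shows "(\<integral>\<^sup>+ y. f y \<partial>measure_pmf (\<omega> x)) = (\<Sum>s\<in>S. f (s \<otimes> x) * rate \<omega> x s)"
proof -
  have "(\<integral>\<^sup>+ y. f y \<partial>measure_pmf (\<omega> x)) = (\<Sum>y\<in>(\<lambda>s. s \<otimes> x) ` S. f y * pmf (\<omega> x) y)"
    using assms S_finite
    by (intro nn_integral_measure_pmf_support) (auto simp: nearest_neighbour_def)
  then show ?thesis
    using inj_mult_right[OF assms(2)] by (simp add: sum.reindex)
qed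

lemma ellipticD:
  assumes "elliptic \<omega>" "x \<in> carrier G" "s \<in> S"
  shows "rate \<omega> x s > 0" "rate \<omega> x (inv s) > 0"
  using assms S_inv by (auto simp: elliptic_def)

lemma sum_rate_onward:
  assumes "elliptic \<omega>" "x \<in> carrier G" "s \<in> S"
  shows "rate \<omega> x (inv s) + (\<Sum>t\<in>onward s. rate \<omega> x t) = 1"
  using sum_rate[of \<omega> x] sum_S_split[OF assms(3), of "rate \<omega> x"] assms by (simp add: elliptic_def)

lemma odds_mono:
  fixes q a b :: real
  assumes "q > 0" "0 \<le> a" "a \<le> b"
  shows "a / (q + a) \<le> b / (q + b)"
  using assms by (simp add: divide_simps) (simp add: algebra_simps mult_left_mono)

lemma escape_bounds:
  assumes "elliptic \<omega>" "x \<in> carrier G" "s \<in> S"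
  shows "0 < escape n \<omega> x s \<and> escape n \<omega> x s \<le> 1"
  using assms
proof (induction n arbitrary: x s)
  case (Suc n)
  have "0 < (\<Sum>t\<in>onward s. rate \<omega> x t * escape n \<omega> (t \<otimes> x) t)"
    using Suc onward_nonempty S_finite by (intro sum_pos) (auto intro!: mult_pos_pos simp: ellipticD)
  then show ?case
    using ellipticD[OF Suc.prems] by (auto simp: divide_simps intro!: add_pos_pos)
qed simp

lemma escape_sum_bounds:
  assumes "elliptic \<omega>" "x \<in> carrier G" "s \<in> S"
  shows "0 < (\<Sum>t\<in>onward s. rate \<omega> x t * escape n \<omega> (t \<otimes> x) t)"
    and "rate \<omega> x (inv s) + (\<Sum>t\<in>onward s. rate \<omega> x t * escape n \<omega> (t \<otimes> x) t) \<le> 1"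
proof -
  have b: "0 < escape n \<omega> (t \<otimes> x) t" "escape n \<omega> (t \<otimes> x) t \<le> 1" if "t \<in> S" for t
    using escape_bounds[OF assms(1), of "t \<otimes> x" t n] that assms by auto
  show "0 < (\<Sum>t\<in>onward s. rate \<omega> x t * escape n \<omega> (t \<otimes> x) t)"
    using assms onward_nonempty S_finite b by (intro sum_pos) (auto intro!: mult_pos_pos simp: ellipticD)
  have "(\<Sum>t\<in>onward s. rate \<omega> x t * escape n \<omega> (t \<otimes> x) t) \<le> (\<Sum>t\<in>onward s. rate \<omega> x t * 1)"
    using b by (intro sum_mono mult_left_mono) auto
  then show "rate \<omega> x (inv s) + (\<Sum>t\<in>onward s. rate \<omega> x t * escape n \<omega> (t \<otimes> x) t) \<le> 1"
    using sum_rate_onward[OF assms] by simp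
qed

lemma one_minus_escape_Suc:
  assumes "elliptic \<omega>" "x \<in> carrier G" "s \<in> S"
  shows "1 - escape (Suc n) \<omega> x s = rate \<omega> x (inv s) /
      (rate \<omega> x (inv s) + (\<Sum>t\<in>onward s. rate \<omega> x t * escape n \<omega> (t \<otimes> x) t))"
    and "rate \<omega> x (inv s) \<le> 1 - escape (Suc n) \<omega> x s"
proof -
  let ?A = "\<Sum>t\<in>onward s. rate \<omega> x t * escape n \<omega> (t \<otimes> x) t"
  have A: "0 < ?A" "rate \<omega> x (inv s) + ?A \<le> 1" and q: "0 < rate \<omega> x (inv s)"
    using escape_sum_bounds[OF assms] ellipticD[OF assms] by auto
  show *: "1 - escape (Suc n) \<omega> x s = rate \<omega> x (inv s) / (rate \<omega> x (inv s) + ?A)"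
    using A q by (simp add: field_simps)
  show "rate \<omega> x (inv s) \<le> 1 - escape (Suc n) \<omega> x s"
    unfolding * using A q by (simp add: divide_simps mult_left_le)
qed

lemma escape_decreasing:
  assumes "elliptic \<omega>" "x \<in> carrier G" "s \<in> S"
  shows "escape (Suc n) \<omega> x s \<le> escape n \<omega> x s"
  using assms(2,3)
proof (induction n arbitrary: x s)
  case 0
  then show ?case using escape_bounds[OF assms(1), of x s 1] by simp
next
  case (Suc n)
  have "(\<Sum>t\<in>onward s. rate \<omega> x t * escape (Suc n) \<omega> (t \<otimes> x) t)
    \<le> (\<Sum>t\<in>onward s. rate \<omega> x t * escape n \<omega> (t \<otimes> x) t)"
    using Suc by (intro sum_mono mult_left_mono Suc.IH) auto
  then show ?case
    unfolding escape.simps(2)[of "Suc n"] escape.simps(2)[of n \<omega> x s]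
    by (intro odds_mono ellipticD[OF assms(1)] Suc.prems less_imp_le[OF escape_sum_bounds(1)[OF assms(1)]])
qed

lemma escape_tendsto:
  assumes "elliptic \<omega>" "x \<in> carrier G" "s \<in> S"
  shows "(\<lambda>n. escape n \<omega> x s) \<longlonglongrightarrow> escape_inf \<omega> x s"
  unfolding escape_inf_def
  using escape_bounds[OF assms]
  by (intro LIMSEQ_decseq_INF decseq_SucI escape_decreasing[OF assms] bdd_belowI[of _ 0]) (auto intro: less_imp_le)

lemma escape_inf_bounds:
  assumes "elliptic \<omega>" "x \<in> carrier G" "s \<in> S"
  shows "0 \<le> escape_inf \<omega> x s" "escape_inf \<omega> x s \<le> 1 - rate \<omega> x (inv s)"
proof -
  show "0 \<le> escape_inf \<omega> x s"
    using escape_bounds[OF assms] by (intro LIMSEQ_le_const[OF escape_tendsto[OF assms]]) (auto intro: less_imp_le)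
  have "escape (Suc n) \<omega> x s \<le> 1 - rate \<omega> x (inv s)" for n
    using one_minus_escape_Suc(2)[OF assms, of n] by linarith
  then show "escape_inf \<omega> x s \<le> 1 - rate \<omega> x (inv s)"
    by (intro LIMSEQ_le_const2[OF LIMSEQ_Suc[OF escape_tendsto[OF assms]]]) auto
qed

lemma escape_inf_recursion:
  assumes "elliptic \<omega>" "x \<in> carrier G" "s \<in> S"
  shows "escape_inf \<omega> x s = (\<Sum>t\<in>onward s. rate \<omega> x t * escape_inf \<omega> (t \<otimes> x) t) /
    (rate \<omega> x (inv s) + (\<Sum>t\<in>onward s. rate \<omega> x t * escape_inf \<omega> (t \<otimes> x) t))"
proof (rule LIMSEQ_unique[OF LIMSEQ_Suc[OF escape_tendsto[OF assms]]])
  have "0 \<le> (\<Sum>t\<in>onward s. rate \<omega> x t * escape_inf \<omega> (t \<otimes> x) t)"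
    using assms by (intro sum_nonneg mult_nonneg_nonneg escape_inf_bounds) auto
  then have "rate \<omega> x (inv s) + (\<Sum>t\<in>onward s. rate \<omega> x t * escape_inf \<omega> (t \<otimes> x) t) \<noteq> 0"
    using ellipticD(2)[OF assms] by linarith
  then show "(\<lambda>n. escape (Suc n) \<omega> x s) \<longlonglongrightarrow> (\<Sum>t\<in>onward s. rate \<omega> x t * escape_inf \<omega> (t \<otimes> x) t) /
    (rate \<omega> x (inv s) + (\<Sum>t\<in>onward s. rate \<omega> x t * escape_inf \<omega> (t \<otimes> x) t))"
    unfolding escape.simps using assms
    by (intro tendsto_intros escape_tendsto) auto
qed

text \<open>The branching step of the zero-one law: one onward direction of positive escape probability
  suffices for escape.\<close>

lemma escape_inf_eq_0_iff:
  assumes "elliptic \<omega>" "x \<in> carrier G" "s \<in> S"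
  shows "escape_inf \<omega> x s = 0 \<longleftrightarrow> (\<forall>t\<in>onward s. escape_inf \<omega> (t \<otimes> x) t = 0)"
proof -
  let ?A = "\<Sum>t\<in>onward s. rate \<omega> x t * escape_inf \<omega> (t \<otimes> x) t"
  have nn: "0 \<le> rate \<omega> x t * escape_inf \<omega> (t \<otimes> x) t" if "t \<in> S" for t
    using assms that by (intro mult_nonneg_nonneg escape_inf_bounds) auto
  have "0 \<le> ?A" by (rule sum_nonneg) (use nn in auto)
  then have "escape_inf \<omega> x s = 0 \<longleftrightarrow> ?A = 0"
    using ellipticD(2)[OF assms] by (subst escape_inf_recursion[OF assms]) auto
  also have "\<dots> \<longleftrightarrow> (\<forall>t\<in>onward s. rate \<omega> x t * escape_inf \<omega> (t \<otimes> x) t = 0)"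
    using S_finite nn by (intro sum_nonneg_eq_0_iff) auto
  also have "\<dots> \<longleftrightarrow> (\<forall>t\<in>onward s. escape_inf \<omega> (t \<otimes> x) t = 0)"
    using ellipticD(1)[OF assms(1,2)] by (intro ball_cong) (auto simp: less_le)
  finally show ?thesis .
qed

subsection \<open>Positive escape probabilities imply transience\<close>

text \<open>If \<open>b\<close> is the escape probability, then this is the probability of ever visiting the root from \<open>x\<close>,
  because the walk has to descend through all the vertices on the path to the root.\<close>

definition return_weight :: "('g \<Rightarrow> real) \<Rightarrow> 'g \<Rightarrow> real" where
  "return_weight b x = (\<Prod>i<len x. 1 - b ((parent ^^ i) x))"

lemma return_weight_one: "return_weight b \<one> = 1"
  by (simp add: return_weight_def)

lemma return_weight_mult:
  assumes "s \<in> S" "x \<in> carrier G" "x = \<one> \<or> s \<noteq> inv (first x)"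
  shows "return_weight b (s \<otimes> x) = (1 - b (s \<otimes> x)) * return_weight b x"
  unfolding return_weight_def len_mult[OF assms] prod.lessThan_Suc_shift
  by (simp add: funpow_swap1 parent_mult[OF assms])

lemma return_weight_parent:
  assumes "x \<in> carrier G" "x \<noteq> \<one>"
  shows "return_weight b x = (1 - b x) * return_weight b (parent x)"
  using return_weight_mult[of "first x" "parent x" b] assms
  by (simp add: first_in_S first_mult_parent first_neq_inv_first_parent)

lemma return_weight_pos:
  assumes "\<And>x. x \<in> carrier G \<Longrightarrow> x \<noteq> \<one> \<Longrightarrow> b x < 1" "x \<in> carrier G"
  shows "return_weight b x > 0"
  using assms(2)
proof (induction "len x" arbitrary: x)
  case 0
  then show ?case by (simp add: return_weight_def)
next
  case (Suc n)
  then have "x \<noteq> \<one>" by auto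
  moreover have "n = len (parent x)"
    using len_parent[OF Suc.prems \<open>x \<noteq> \<one>\<close>] Suc.hyps(2) by (simp only: parent_def)
  ultimately show ?case
    using Suc assms(1)[of x] by (simp add: return_weight_parent)
qed

text \<open>With the full escape probability in place of its half, the function would be the hitting
  probability of the root, hence harmonic away from the root.  Halving makes the inequality strict at
  every vertex, so that one function bounds the number of visits to every vertex.\<close>

lemma return_weight_strictly_superharmonic:
  assumes ell: "elliptic \<omega>"
    and pos: "\<And>x s. x \<in> carrier G \<Longrightarrow> s \<in> S \<Longrightarrow> escape_inf \<omega> x s > 0"
    and x: "x \<in> carrier G"
  defines "b \<equiv> \<lambda>x. escape_inf \<omega> x (first x) / 2"
  shows "(\<Sum>s\<in>S. rate \<omega> x s * return_weight b (s \<otimes> x)) < return_weight b x"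
proof -
  let ?u = "return_weight b"
  have b_mult: "b (s \<otimes> x) = escape_inf \<omega> (s \<otimes> x) s / 2" if "s \<in> S" "x = \<one> \<or> s \<noteq> inv (first x)" for s
    using that x by (simp add: b_def first_mult)
  show ?thesis
  proof (cases "x = \<one>")
    case True
    have S: "S \<noteq> {}" using S_card by auto
    have "(\<Sum>s\<in>S. rate \<omega> x s * ?u (s \<otimes> x)) = (\<Sum>s\<in>S. rate \<omega> x s * (1 - b (s \<otimes> x)))"
    proof (intro sum.cong refl)
      fix s assume "s \<in> S"
      then show "rate \<omega> x s * ?u (s \<otimes> x) = rate \<omega> x s * (1 - b (s \<otimes> x))"
        using return_weight_mult[OF _ x disjI1[OF True], of s b] True by (simp add: return_weight_one)
    qed
    also have "\<dots> < (\<Sum>s\<in>S. rate \<omega> x s)"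
    proof (rule sum_strict_mono)
      fix s assume s: "s \<in> S"
      have "0 < rate \<omega> x s * b (s \<otimes> x)"
        unfolding b_mult[OF s disjI1[OF True]]
        using ellipticD(1)[OF ell x s] pos[of "s \<otimes> x" s] s x by simp
      then show "rate \<omega> x s * (1 - b (s \<otimes> x)) < rate \<omega> x s" by (simp add: algebra_simps)
    qed (use S_finite S in auto)
    also have "\<dots> = ?u x"
      using sum_rate[of \<omega> x] ell x True by (simp add: elliptic_def return_weight_one)
    finally show ?thesis .
  next
    case False
    let ?s = "first x" and ?p = "parent x"
    let ?A = "\<Sum>t\<in>onward ?s. rate \<omega> x t * escape_inf \<omega> (t \<otimes> x) t"
    let ?q = "rate \<omega> x (inv ?s)"
    have s: "?s \<in> S" by (rule first_in_S[OF x False])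
    have q: "?q > 0" using ellipticD(2)[OF ell x s] .
    have A: "?A > 0"
      using S_finite onward_nonempty[OF s] ell x s
      by (intro sum_pos) (auto intro!: mult_pos_pos pos simp: ellipticD)
    have bx: "b x = ?A / (?q + ?A) / 2"
      unfolding b_def by (subst escape_inf_recursion[OF ell x s]) simp
    have up: "?u ?p > 0"
    proof (rule return_weight_pos)
      fix y assume y: "y \<in> carrier G" "y \<noteq> \<one>"
      then show "b y < 1"
        using escape_inf_bounds(2)[OF ell y(1) first_in_S[OF y]] ellipticD(2)[OF ell y(1) first_in_S[OF y]]
        by (simp add: b_def)
    qed (use x False in simp)
    have "(\<Sum>s\<in>S. rate \<omega> x s * ?u (s \<otimes> x)) =
        ?q * ?u ?p + (\<Sum>t\<in>onward ?s. rate \<omega> x t * ((1 - b (t \<otimes> x)) * ?u x))"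
      unfolding sum_S_split[OF s, of "\<lambda>s. rate \<omega> x s * ?u (s \<otimes> x)"] parent_def[symmetric]
      using x by (intro arg_cong2[of _ _ _ _ "(+)"] sum.cong refl) (simp_all add: return_weight_mult)
    also have "(\<Sum>t\<in>onward ?s. rate \<omega> x t * ((1 - b (t \<otimes> x)) * ?u x)) =
        (\<Sum>t\<in>onward ?s. (rate \<omega> x t - rate \<omega> x t * escape_inf \<omega> (t \<otimes> x) t / 2) * ?u x)"
      by (intro sum.cong refl) (simp add: b_mult algebra_simps)
    also have "\<dots> = ((\<Sum>t\<in>onward ?s. rate \<omega> x t) - ?A / 2) * ?u x"
      by (simp only: sum_distrib_right[symmetric] sum_subtractf sum_divide_distrib[symmetric])
    also have "(\<Sum>t\<in>onward ?s. rate \<omega> x t) = 1 - ?q"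
      using sum_rate_onward[OF ell x s] by linarith
    also have "?u x = (1 - b x) * ?u ?p" by (rule return_weight_parent[OF x False])
    finally have "(\<Sum>s\<in>S. rate \<omega> x s * ?u (s \<otimes> x)) =
        (?q + (1 - ?q - ?A / 2) * (1 - b x)) * ?u ?p" by (simp add: algebra_simps)
    also have "\<dots> < (1 - b x) * ?u ?p"
    proof (rule mult_strict_right_mono[OF _ up])
      (* Without the factors 1/2 this is the equation b = A / (q + A). *)
      have "b x * (?q + ?A / 2) < ?A / 2"
        unfolding bx using q A by (simp add: divide_simps)
      then show "?q + (1 - ?q - ?A / 2) * (1 - b x) < 1 - b x" by (simp add: algebra_simps)
    qed
    also have "\<dots> = ?u x" by (rule return_weight_parent[OF x False, symmetric])
    finally show ?thesis .
  qed
qed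

lemma transient_if_escape_inf_pos:
  assumes ell: "elliptic \<omega>"
    and pos: "\<And>x s. x \<in> carrier G \<Longrightarrow> s \<in> S \<Longrightarrow> escape_inf \<omega> x s > 0"
  shows "AE X in quenched G \<omega> \<one>. filterlim (\<lambda>n. root_dist G S (X n)) at_top sequentially"
proof -
  have nn: "nearest_neighbour \<omega>" using ell by (simp add: elliptic_def)
  interpret walk_in_environment G \<omega> \<one>
    using nearest_neighbourD[OF nn] by unfold_locales auto
  define b where "b = (\<lambda>x. escape_inf \<omega> x (first x) / 2)"
  define u where "u = return_weight b"
  define Pu where "Pu x = (\<Sum>s\<in>S. rate \<omega> x s * u (s \<otimes> x))" for x
  have less: "Pu x < u x" if "x \<in> carrier G" for x
    unfolding Pu_def u_def b_def by (rule return_weight_strictly_superharmonic[OF ell pos that])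
  have "b y < 1" if y: "y \<in> carrier G" "y \<noteq> \<one>" for y
    using escape_inf_bounds(2)[OF ell y(1) first_in_S[OF y]] ellipticD(2)[OF ell y(1) first_in_S[OF y]]
    by (simp add: b_def)
  then have u_pos: "u x > 0" if "x \<in> carrier G" for x
    using return_weight_pos[of b] that by (simp add: u_def)
  have u_nn: "0 \<le> u (s \<otimes> x)" if "x \<in> carrier G" "s \<in> S" for x s
    using u_pos[of "s \<otimes> x"] that by auto
  have Pu: "(\<integral>\<^sup>+ y. ennreal (u y) \<partial>measure_pmf (\<omega> x)) = ennreal (Pu x)" if "x \<in> carrier G" for x
    unfolding nn_integral_nearest_neighbour[OF nn that] Pu_def
    using u_nn[OF that] by (subst sum_ennreal[symmetric])
      (auto intro!: sum.cong mult_nonneg_nonneg simp: ennreal_mult'' mult.commute)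
  have Pu_nn: "Pu x \<ge> 0" if "x \<in> carrier G" for x
    unfolding Pu_def using that by (intro sum_nonneg mult_nonneg_nonneg u_nn) auto
  have "AE X in quenched G \<omega> \<one>. finite {n. X n = v}" if v: "v \<in> carrier G" for v
  proof (rule strictly_superharmonic_finitely_many_visits[where u="\<lambda>x. ennreal (u x)" and g="\<lambda>x. ennreal (u x - Pu x)"])
    show "(\<integral>\<^sup>+ y. ennreal (u y) \<partial>measure_pmf (\<omega> x)) + ennreal (u x - Pu x) \<le> ennreal (u x)" if "x \<in> carrier G" for x
      using less[OF that] Pu_nn[OF that] by (simp add: Pu[OF that] ennreal_plus[symmetric] del: ennreal_plus)
    show "ennreal (u v - Pu v) > 0" using less[OF v] by simp
  qed simp
  then have "AE X in quenched G \<omega> \<one>. \<forall>v\<in>carrier G. finite {n. X n = v}"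
    using countable_carrier by (simp add: AE_ball_countable)
  then show ?thesis
  proof (rule AE_mp, intro AE_I2 impI)
    fix X assume X: "X \<in> space (quenched G \<omega> \<one>)" and fin: "\<forall>v\<in>carrier G. finite {n. X n = v}"
    have XG: "X n \<in> carrier G" for n
      using X by (auto simp: space_quenched path_space_def space_PiM)
    show "filterlim (\<lambda>n. root_dist G S (X n)) at_top sequentially"
      unfolding filterlim_at_top
    proof
      fix Z
      have "{n. \<not> Z \<le> len (X n)} \<subseteq> (\<Union>v\<in>{x \<in> carrier G. len x \<le> Z}. {n. X n = v})"
        using XG by auto
      moreover have "finite (\<Union>v\<in>{x \<in> carrier G. len x \<le> Z}. {n. X n = v})"
        using fin finite_balls by auto
      ultimately have "finite {n. \<not> Z \<le> len (X n)}" by (rule finite_subset)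
      then show "\<forall>\<^sub>F n in sequentially. Z \<le> root_dist G S (X n)"
        by (simp add: cofinite_eq_sequentially[symmetric] eventually_cofinite root_dist_eq_len XG)
    qed
  qed
qed

end


section \<open>Measurability and translation of environments\<close>

lemma space_borel_algebra [simp]: "space (borel_algebra T) = topspace T"
  by (simp add: borel_algebra_def space_measure_of_conv)

lemma space_laws_at [simp]: "space (laws_at G T x) = map_pmf (translate G x) ` topspace T"
  by (simp add: laws_at_def space_measure_of_conv)

lemma open_in_laws_at:
  assumes "openin T U"
  shows "map_pmf (translate G x) ` U \<in> sets (laws_at G T x)"
  unfolding laws_at_def using assms
  by (subst sets_measure_of) (auto dest: openin_subset intro!: sigma_sets.Basic)

context tree_gen_group
begin

lemma inj_on_translate: "x \<in> carrier G \<Longrightarrow> inj_on (translate G x) (carrier G)"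
  by (auto simp: inj_on_def translate_def)

text \<open>Translation is injective only on the carrier, so that the support has to be controlled.\<close>

lemma pmf_map_translate:
  assumes p: "set_pmf p \<subseteq> carrier G" and x: "x \<in> carrier G" and w: "w \<in> carrier G"
  shows "pmf (map_pmf (translate G x) p) w = pmf p (w \<otimes> inv x)"
proof -
  have tw: "translate G x (w \<otimes> inv x) = w" using x w by (simp add: translate_def m_assoc)
  show ?thesis
  proof (cases "w \<otimes> inv x \<in> set_pmf p")
    case True
    have "pmf (map_pmf (translate G x) p) (translate G x (w \<otimes> inv x)) = pmf p (w \<otimes> inv x)"
      using inj_on_subset[OF inj_on_translate[OF x] p] True by (rule pmf_map_inj)
    then show ?thesis by (simp only: tw)
  next
    case False
    have "w \<notin> translate G x ` set_pmf p"
    proof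
      assume "w \<in> translate G x ` set_pmf p"
      then obtain y where y: "y \<in> set_pmf p" "w = y \<otimes> x" by (auto simp: translate_def)
      then have "y \<in> carrier G" using p by auto
      then have "w \<otimes> inv x = y" using x y(2) by (simp add: m_assoc)
      then show False using y False by simp
    qed
    then show ?thesis using False by (simp add: pmf_map_outside set_pmf_iff)
  qed
qed

lemma map_translate_translate:
  assumes "set_pmf p \<subseteq> carrier G" "x \<in> carrier G" "y \<in> carrier G"
  shows "map_pmf (translate G y) (map_pmf (translate G x) p) = map_pmf (translate G (x \<otimes> y)) p"
  unfolding pmf.map_comp using assms
  by (intro map_pmf_cong refl) (auto simp: translate_def m_assoc)

lemma map_translate_one: "set_pmf p \<subseteq> carrier G \<Longrightarrow> map_pmf (translate G \<one>) p = p"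
  using map_pmf_cong[OF refl, of p "translate G \<one>" id] by (simp add: translate_def map_pmf_id subset_iff)

lemma map_translate_inj:
  assumes "set_pmf p \<subseteq> carrier G" "set_pmf q \<subseteq> carrier G" "x \<in> carrier G"
    and "map_pmf (translate G x) p = map_pmf (translate G x) q"
  shows "p = q"
proof -
  have inverse: "map_pmf (translate G (inv x)) (map_pmf (translate G x) p') = p'" if "set_pmf p' \<subseteq> carrier G" for p'
    using map_translate_translate[OF that assms(3), of "inv x"] map_translate_one[OF that] assms(3) by simp
  have "p = map_pmf (translate G (inv x)) (map_pmf (translate G x) p)" by (rule inverse[OF assms(1), symmetric])
  also have "\<dots> = map_pmf (translate G (inv x)) (map_pmf (translate G x) q)" by (simp only: assms(4))
  also have "\<dots> = q" by (rule inverse[OF assms(2)])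
  finally show ?thesis .
qed

text \<open>The measurable structures at all vertices are copies of the one at the root, and translations
  compose.  So the translations between them, and with them all questions of measurability at a vertex,
  reduce to the root.\<close>

lemma measurable_map_translate:
  assumes T: "topspace T \<subseteq> {p. set_pmf p \<subseteq> carrier G}" and z: "z \<in> carrier G" and x: "x \<in> carrier G"
  shows "map_pmf (translate G x) \<in> laws_at G T z \<rightarrow>\<^sub>M laws_at G T (z \<otimes> x)"
  unfolding laws_at_def[of G T "z \<otimes> x"]
proof (rule measurable_measure_of)
  show "{map_pmf (translate G (z \<otimes> x)) ` U |U. openin T U} \<subseteq> Pow (map_pmf (translate G (z \<otimes> x)) ` topspace T)"
    by (auto dest: openin_subset)
  have tt: "map_pmf (translate G x) (map_pmf (translate G z) p) = map_pmf (translate G (z \<otimes> x)) p"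
    if "p \<in> topspace T" for p
    using map_translate_translate[of p z x] that T z x by auto
  show "map_pmf (translate G x) \<in> space (laws_at G T z) \<rightarrow> map_pmf (translate G (z \<otimes> x)) ` topspace T"
    by (auto simp: tt)
  fix A assume "A \<in> {map_pmf (translate G (z \<otimes> x)) ` U |U. openin T U}"
  then obtain U where U: "openin T U" and A: "A = map_pmf (translate G (z \<otimes> x)) ` U" by blast
  have "map_pmf (translate G x) -` A \<inter> space (laws_at G T z) = map_pmf (translate G z) ` U"
  proof
    show "map_pmf (translate G z) ` U \<subseteq> map_pmf (translate G x) -` A \<inter> space (laws_at G T z)"
      using openin_subset[OF U] by (auto simp: A tt intro!: imageI)
    show "map_pmf (translate G x) -` A \<inter> space (laws_at G T z) \<subseteq> map_pmf (translate G z) ` U"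
    proof
      fix q assume q: "q \<in> map_pmf (translate G x) -` A \<inter> space (laws_at G T z)"
      then obtain p where p: "p \<in> topspace T" "q = map_pmf (translate G z) p" by auto
      obtain p' where p': "p' \<in> U" "map_pmf (translate G x) q = map_pmf (translate G (z \<otimes> x)) p'"
        using q by (auto simp: A)
      have "p = p'"
        using p p' openin_subset[OF U] T z x
        by (intro map_translate_inj[of p p' "z \<otimes> x"]) (auto simp: tt)
      then show "q \<in> map_pmf (translate G z) ` U" using p p' by auto
    qed
  qed
  then show "map_pmf (translate G x) -` A \<inter> space (laws_at G T z) \<in> sets (laws_at G T z)"
    using open_in_laws_at[OF U] by simp
qed

lemma laws_at_one:
  assumes T: "topspace T \<subseteq> {p. set_pmf p \<subseteq> carrier G}"
  shows "laws_at G T \<one> = borel_algebra T"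
proof -
  have "map_pmf (translate G \<one>) ` U = U" if "U \<subseteq> topspace T" for U
  proof -
    have "map_pmf (translate G \<one>) p = p" if "p \<in> U" for p
      using that \<open>U \<subseteq> topspace T\<close> T by (intro map_translate_one) auto
    then show ?thesis by auto
  qed
  then have "{map_pmf (translate G \<one>) ` U |U. openin T U} = {U. openin T U}"
    "map_pmf (translate G \<one>) ` topspace T = topspace T"
    by (auto dest: openin_subset) (metis openin_subset)+
  then show ?thesis by (simp add: laws_at_def borel_algebra_def)
qed

end

locale random_tree_environment = tree_gen_group G S len first
  for G :: "'g monoid" (structure) and S len first +
  fixes T :: "'g pmf topology" and P :: "('g \<Rightarrow> 'g pmf) measure"
  assumes law: "law_space S T" and distribution: "env_distribution G T P" and iid: "iid_environment G T P"
begin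

sublocale prob_space P
  using distribution by (simp add: env_distribution_def)

lemma sets_P [measurable_cong]: "sets P = sets (PiM (carrier G) (laws_at G T))"
  using distribution by (simp add: env_distribution_def env_space_def)

lemma space_P: "space P = (\<Pi>\<^sub>E x\<in>carrier G. map_pmf (translate G x) ` topspace T)"
  by (simp add: sets_eq_imp_space_eq[OF sets_P] space_PiM)

lemma topspace_S: "p \<in> topspace T \<Longrightarrow> set_pmf p \<subseteq> S"
  using law by (auto simp: law_space_def)

lemma topspace_carrier: "topspace T \<subseteq> {p. set_pmf p \<subseteq> carrier G}"
  using topspace_S S_subset by blast

lemma nearest_neighbour_P: "\<omega> \<in> space P \<Longrightarrow> nearest_neighbour \<omega>"
  using topspace_S by (fastforce simp: nearest_neighbour_def space_P translate_def dest!: PiE_mem)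

lemma measurable_rate:
  assumes x: "x \<in> carrier G" and s: "s \<in> S"
  shows "(\<lambda>q. pmf q (s \<otimes> x)) \<in> borel_measurable (laws_at G T x)"
proof -
  have "(\<lambda>p. pmf p s) \<in> borel_measurable (laws_at G T \<one>)"
    using law s unfolding laws_at_one[OF topspace_carrier] by (auto simp: law_space_def)
  moreover have "map_pmf (translate G (inv x)) \<in> laws_at G T x \<rightarrow>\<^sub>M laws_at G T \<one>"
    using measurable_map_translate[OF topspace_carrier x, of "inv x"] x by simp
  ultimately have "(\<lambda>q. pmf (map_pmf (translate G (inv x)) q) s) \<in> borel_measurable (laws_at G T x)"
    by (rule measurable_compose[rotated])
  moreover have "pmf (map_pmf (translate G (inv x)) q) s = pmf q (s \<otimes> x)" if "q \<in> space (laws_at G T x)" for q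
  proof -
    have "set_pmf q \<subseteq> carrier G"
      using that x topspace_carrier by (fastforce simp: translate_def)
    then show ?thesis using pmf_map_translate[of q "inv x" s] x s by auto
  qed
  ultimately show ?thesis by (subst measurable_cong[symmetric]) auto
qed

lemma measurable_rate_PiM [measurable]:
  assumes "x \<in> J" "J \<subseteq> carrier G" "s \<in> S"
  shows "(\<lambda>\<omega>. rate \<omega> x s) \<in> borel_measurable (PiM J (laws_at G T))"
proof (rule measurable_compose[where f="\<lambda>\<omega>. \<omega> x" and g="\<lambda>q. pmf q (s \<otimes> x)"])
  show "(\<lambda>\<omega>. \<omega> x) \<in> PiM J (laws_at G T) \<rightarrow>\<^sub>M laws_at G T x"
    using assms(1) by (rule measurable_component_singleton)
  show "(\<lambda>q. pmf q (s \<otimes> x)) \<in> borel_measurable (laws_at G T x)"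
    using assms by (intro measurable_rate) auto
qed

lemma measurable_rate_P:
  assumes "x \<in> carrier G" "s \<in> S"
  shows "(\<lambda>\<omega>. rate \<omega> x s) \<in> borel_measurable P"
  unfolding measurable_cong_sets[OF sets_P refl] using assms by (intro measurable_rate_PiM) auto

lemma measurable_transition_P:
  assumes x: "x \<in> carrier G" and y: "y \<in> carrier G"
  shows "(\<lambda>\<omega>. pmf (\<omega> x) y) \<in> borel_measurable P"
proof (cases "y \<otimes> inv x \<in> S")
  case True
  then show ?thesis using measurable_rate_P[OF x True] x y by (simp add: m_assoc)
next
  case False
  have "pmf (\<omega> x) y = 0" if "\<omega> \<in> space P" for \<omega>
  proof -
    have "y \<noteq> s \<otimes> x" if "s \<in> S" for s using that False x by (auto simp: m_assoc)
    then show ?thesis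
      using nearest_neighbour_P[OF that] x by (auto simp: nearest_neighbour_def pmf_eq_0_set_pmf)
  qed
  then show ?thesis by (subst measurable_cong) auto
qed

subsection \<open>Escape probabilities as random variables\<close>

text \<open>The set of pairs \<open>(x, s)\<close> that the recursion for the escape probabilities visits.  It is used for the
  whole tree, to obtain random variables, and for a single subtree, to see that an escape probability
  depends only on the environment inside this subtree.\<close>

definition onward_closed :: "('g \<times> 'g) set \<Rightarrow> bool" where
  "onward_closed K \<longleftrightarrow> K \<subseteq> carrier G \<times> S \<and> (\<forall>x s t. (x, s) \<in> K \<longrightarrow> t \<in> onward s \<longrightarrow> (t \<otimes> x, t) \<in> K)"

lemma onward_closedD:
  assumes "onward_closed K" "(x, s) \<in> K"
  shows "x \<in> carrier G" "s \<in> S" "t \<in> onward s \<Longrightarrow> (t \<otimes> x, t) \<in> K"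
  using assms by (auto simp: onward_closed_def)

lemma measurable_escape:
  assumes K: "onward_closed K" and J: "fst ` K \<subseteq> J" "J \<subseteq> carrier G" and xs: "(x, s) \<in> K"
  shows "(\<lambda>\<omega>. escape n \<omega> x s) \<in> borel_measurable (PiM J (laws_at G T))"
  using xs
proof (induction n arbitrary: x s)
  case (Suc n)
  have x: "x \<in> J" using Suc.prems J by force
  show ?case
    unfolding escape.simps
    using x J(2) onward_closedD[OF K Suc.prems] S_inv Suc.IH
    by (intro borel_measurable_divide borel_measurable_add borel_measurable_sum borel_measurable_times measurable_rate_PiM) auto
qed simp

lemma escape_local:
  assumes K: "onward_closed K" and J: "fst ` K \<subseteq> J" and eq: "\<And>x. x \<in> J \<Longrightarrow> \<omega> x = \<omega>' x" and xs: "(x, s) \<in> K"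
  shows "escape n \<omega> x s = escape n \<omega>' x s"
  using xs
proof (induction n arbitrary: x s)
  case (Suc n)
  have "\<omega> x = \<omega>' x" using Suc.prems J by (intro eq) force
  moreover have "escape n \<omega> (t \<otimes> x) t = escape n \<omega>' (t \<otimes> x) t" if "t \<in> onward s" for t
    by (rule Suc.IH[OF onward_closedD(3)[OF K Suc.prems that]])
  ultimately show ?case by (simp cong: sum.cong_simp)
qed simp

lemma escape_nonneg: "0 \<le> escape n \<omega> x s"
  by (induction n arbitrary: x s) (auto intro!: divide_nonneg_nonneg add_nonneg_nonneg sum_nonneg mult_nonneg_nonneg)

lemma measurable_escape_inf:
  assumes "onward_closed K" "fst ` K \<subseteq> J" "J \<subseteq> carrier G" "(x, s) \<in> K"
  shows "(\<lambda>\<omega>. escape_inf \<omega> x s) \<in> borel_measurable (PiM J (laws_at G T))"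
  unfolding escape_inf_def
  by (intro borel_measurable_cINF measurable_escape[OF assms]) (auto intro!: bdd_belowI[of _ 0] escape_nonneg)

lemma onward_closed_UNIV: "onward_closed (carrier G \<times> S)"
  by (auto simp: onward_closed_def)

lemma measurable_escape_P [measurable]:
  assumes "x \<in> carrier G" "s \<in> S"
  shows "(\<lambda>\<omega>. escape n \<omega> x s) \<in> borel_measurable P" "(\<lambda>\<omega>. escape_inf \<omega> x s) \<in> borel_measurable P"
  unfolding measurable_cong_sets[OF sets_P refl]
  using assms measurable_escape[OF onward_closed_UNIV, of "carrier G" x s]
    measurable_escape_inf[OF onward_closed_UNIV, of "carrier G" x s] by auto

subsection \<open>Invariance under translations\<close>

lemma rate_translate_env:
  assumes \<omega>: "\<omega> \<in> space P" and z: "z \<in> carrier G" and x: "x \<in> carrier G" and s: "s \<in> S"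
  shows "rate (translate_env G z \<omega>) x s = rate \<omega> (x \<otimes> inv z) s"
proof -
  have "set_pmf (\<omega> (x \<otimes> inv z)) \<subseteq> carrier G"
    using nearest_neighbourD[OF nearest_neighbour_P[OF \<omega>]] x z by simp
  then show ?thesis
    using x z s by (simp add: translate_env_def pmf_map_translate m_assoc)
qed

lemma escape_translate_env:
  assumes \<omega>: "\<omega> \<in> space P" and z: "z \<in> carrier G" and x: "x \<in> carrier G" and s: "s \<in> S"
  shows "escape n (translate_env G z \<omega>) x s = escape n \<omega> (x \<otimes> inv z) s"
  using x s
proof (induction n arbitrary: x s)
  case (Suc n)
  have "(\<Sum>t\<in>onward s. rate (translate_env G z \<omega>) x t * escape n (translate_env G z \<omega>) (t \<otimes> x) t) =
      (\<Sum>t\<in>onward s. rate \<omega> (x \<otimes> inv z) t * escape n \<omega> (t \<otimes> (x \<otimes> inv z)) t)"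
    using Suc z by (intro sum.cong refl) (simp add: rate_translate_env[OF \<omega> z] m_assoc)
  then show ?case
    using Suc.prems S_inv by (simp add: rate_translate_env[OF \<omega> z])
qed simp

lemma escape_inf_translate_env:
  assumes "\<omega> \<in> space P" "z \<in> carrier G" "x \<in> carrier G" "s \<in> S"
  shows "escape_inf (translate_env G z \<omega>) x s = escape_inf \<omega> (x \<otimes> inv z) s"
  by (simp add: escape_inf_def escape_translate_env[OF assms])

lemma measurable_translate_env:
  assumes z: "z \<in> carrier G"
  shows "translate_env G z \<in> P \<rightarrow>\<^sub>M env_space G T"
  unfolding measurable_cong_sets[OF sets_P refl] env_space_def translate_env_def[abs_def]
proof (rule measurable_restrict)
  fix y assume y: "y \<in> carrier G"
  have "map_pmf (translate G z) \<in> laws_at G T (y \<otimes> inv z) \<rightarrow>\<^sub>M laws_at G T y"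
    using measurable_map_translate[OF topspace_carrier, of "y \<otimes> inv z" z] y z by (simp add: m_assoc)
  then show "(\<lambda>\<omega>. map_pmf (translate G z) (\<omega> (y \<otimes> inv z))) \<in> PiM (carrier G) (laws_at G T) \<rightarrow>\<^sub>M laws_at G T y"
    using y z by (intro measurable_compose[OF measurable_component_singleton]) auto
qed

lemma distr_translate_env: "z \<in> carrier G \<Longrightarrow> distr P (env_space G T) (translate_env G z) = P"
  using iid by (simp add: iid_environment_def)

lemma integral_translate:
  fixes f :: "('g \<Rightarrow> 'g pmf) \<Rightarrow> real"
  assumes z: "z \<in> carrier G" and f: "f \<in> borel_measurable P"
    and eq: "\<And>\<omega>. \<omega> \<in> space P \<Longrightarrow> f (translate_env G z \<omega>) = g \<omega>"
  shows "integrable P g \<longleftrightarrow> integrable P f" "integral\<^sup>L P g = integral\<^sup>L P f"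
proof -
  have f': "f \<in> borel_measurable (env_space G T)"
    using f unfolding env_space_def measurable_cong_sets[OF sets_P refl] .
  have "integrable P g \<longleftrightarrow> integrable P (\<lambda>\<omega>. f (translate_env G z \<omega>))"
    by (rule Bochner_Integration.integrable_cong) (auto simp: eq)
  also have "\<dots> \<longleftrightarrow> integrable (distr P (env_space G T) (translate_env G z)) f"
    by (rule integrable_distr_eq[OF measurable_translate_env[OF z] f', symmetric])
  finally show "integrable P g \<longleftrightarrow> integrable P f" by (simp add: distr_translate_env[OF z])
  have "integral\<^sup>L P g = (\<integral>\<omega>. f (translate_env G z \<omega>) \<partial>P)"
    by (rule Bochner_Integration.integral_cong) (auto simp: eq)
  also have "\<dots> = integral\<^sup>L (distr P (env_space G T) (translate_env G z)) f"
    by (rule integral_distr[OF measurable_translate_env[OF z] f', symmetric])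
  finally show "integral\<^sup>L P g = integral\<^sup>L P f" by (simp add: distr_translate_env[OF z])
qed

lemma AE_translate:
  assumes z: "z \<in> carrier G" and R: "Measurable.pred P R"
    and eq: "\<And>\<omega>. \<omega> \<in> space P \<Longrightarrow> R (translate_env G z \<omega>) \<longleftrightarrow> R' \<omega>"
  shows "(AE \<omega> in P. R' \<omega>) \<longleftrightarrow> (AE \<omega> in P. R \<omega>)"
proof -
  have "Measurable.pred (env_space G T) R"
    using R unfolding env_space_def measurable_cong_sets[OF sets_P refl] .
  then have "{\<omega> \<in> space (env_space G T). R \<omega>} \<in> sets (env_space G T)" by (rule predE)
  then have "(AE \<omega> in distr P (env_space G T) (translate_env G z). R \<omega>) \<longleftrightarrow> (AE \<omega> in P. R (translate_env G z \<omega>))"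
    by (rule AE_distr_iff[OF measurable_translate_env[OF z]])
  also have "\<dots> \<longleftrightarrow> (AE \<omega> in P. R' \<omega>)"
    by (rule AE_cong) (auto simp: eq)
  finally have "(AE \<omega> in P. R \<omega>) \<longleftrightarrow> (AE \<omega> in P. R' \<omega>)"
    unfolding distr_translate_env[OF z] .
  then show ?thesis by (rule sym)
qed

end


section \<open>Escape probabilities do not degenerate\<close>

text \<open>The inequality of the arithmetic and geometric means, from \<open>ln y \<le> y - 1\<close> at the ratios of the
  summands to their mean.\<close>

lemma ln_sum_ge:
  fixes a :: "'a \<Rightarrow> real"
  assumes "finite A" "A \<noteq> {}" and a: "\<And>t. t \<in> A \<Longrightarrow> a t > 0"
  shows "ln (card A) + (\<Sum>t\<in>A. ln (a t)) / card A \<le> ln (\<Sum>t\<in>A. a t)"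
proof -
  let ?c = "real (card A)" and ?M = "(\<Sum>t\<in>A. a t) / real (card A)"
  have c: "?c > 0" using assms by (simp add: card_gt_0_iff)
  have sum: "(\<Sum>t\<in>A. a t) > 0" using assms by (intro sum_pos) auto
  then have M: "?M > 0" using c by simp
  have "ln (a t / ?M) = ln (a t) - ln ?M" if "t \<in> A" for t
    using a[OF that] M by (rule ln_divide_pos)
  then have "(\<Sum>t\<in>A. ln (a t)) - ?c * ln ?M = (\<Sum>t\<in>A. ln (a t / ?M))"
    by (simp add: sum_subtractf)
  also have "\<dots> \<le> (\<Sum>t\<in>A. a t / ?M - 1)"
    by (intro sum_mono ln_le_minus_one divide_pos_pos a M)
  also have "\<dots> = (\<Sum>t\<in>A. a t) / ?M - ?c"
    by (simp only: sum_subtractf sum_divide_distrib sum_constant mult_1_right)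
  also have "\<dots> = 0"
    using c sum by simp
  finally have "(\<Sum>t\<in>A. ln (a t)) / ?c \<le> ln ?M"
    using c by (simp add: divide_simps mult.commute)
  also have "ln ?M = ln (\<Sum>t\<in>A. a t) - ln ?c"
    using c sum by (simp add: ln_div)
  finally show ?thesis by simp
qed

lemma abs_log_measurable [measurable]: "abs_log \<in> borel_measurable borel"
  unfolding abs_log_def[abs_def] by measurable

text \<open>Each generator is onward for all generators but its inverse.\<close>

lemma (in tree_gen_group) sum_sum_onward: "(\<Sum>s\<in>S. \<Sum>t\<in>onward s. f t) = real (card S - 1) * (\<Sum>t\<in>S. f t)"
  for f :: "'g \<Rightarrow> real"
proof -
  have "(\<Sum>t\<in>onward s. f t) = (\<Sum>t\<in>S. f t) - f (inv s)" if "s \<in> S" for s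
    using sum_S_split[OF that, of f] by simp
  then have "(\<Sum>s\<in>S. \<Sum>t\<in>onward s. f t) = real (card S) * (\<Sum>t\<in>S. f t) - (\<Sum>s\<in>S. f (inv s))"
    by (simp add: sum_subtractf)
  also have "(\<Sum>s\<in>S. f (inv s)) = (\<Sum>t\<in>S. f t)"
    by (rule sum.reindex_bij_witness[of _ "\<lambda>s. inv s" "\<lambda>s. inv s"]) (auto simp: S_inv)
  finally show ?thesis using S_card by (simp add: of_nat_diff algebra_simps)
qed

lemma (in prob_space) expectation_affine_sum:
  fixes f :: "'b \<Rightarrow> 'a \<Rightarrow> real"
  assumes "\<And>t. t \<in> A \<Longrightarrow> integrable M (f t)" "integrable M g"
  shows "integrable M (\<lambda>\<omega>. a + (\<Sum>t\<in>A. f t \<omega>) / c - g \<omega>)"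
    and "expectation (\<lambda>\<omega>. a + (\<Sum>t\<in>A. f t \<omega>) / c - g \<omega>) = a + (\<Sum>t\<in>A. expectation (f t)) / c - expectation g"
  using assms by (simp_all add: prob_space)

locale log_integrable_environment = random_tree_environment +
  assumes log_integrable: "s \<in> S \<Longrightarrow> (\<integral>\<^sup>+ \<omega>. abs_log (pmf (\<omega> \<one>) s) \<partial>P) < \<infinity>"
begin

(* The escape probabilities are opaque random variables from here on. *)
declare escape.simps(2) [simp del]

lemma measurable_rate_one [measurable]: "s \<in> S \<Longrightarrow> (\<lambda>\<omega>. pmf (\<omega> \<one>) s) \<in> borel_measurable P"
  using measurable_rate_P[of \<one> s] by simp

lemma AE_rate_pos:
  assumes x: "x \<in> carrier G" and s: "s \<in> S"
  shows "AE \<omega> in P. rate \<omega> x s > 0"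
proof -
  have [measurable]: "(\<lambda>\<omega>. pmf (\<omega> \<one>) s) \<in> borel_measurable P" using s by (rule measurable_rate_one)
  have "AE \<omega> in P. abs_log (pmf (\<omega> \<one>) s) \<noteq> \<infinity>"
    using log_integrable[OF s] by (intro nn_integral_PInf_AE) auto
  then have "AE \<omega> in P. rate \<omega> \<one> s > 0"
    by eventually_elim (use s in \<open>auto simp: abs_log_def pmf_pos less_le split: if_splits\<close>)
  moreover have "rate (translate_env G (inv x) \<omega>) \<one> s = rate \<omega> x s" if "\<omega> \<in> space P" for \<omega>
    using rate_translate_env[OF that, of "inv x" \<one> s] x s by simp
  moreover have "Measurable.pred P (\<lambda>\<omega>. rate \<omega> \<one> s > 0)"
    using s by simp
  ultimately show ?thesis
    using x by (subst AE_translate[of "inv x" "\<lambda>\<omega>. rate \<omega> \<one> s > 0"]) auto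
qed

lemma AE_elliptic: "AE \<omega> in P. elliptic \<omega>"
proof -
  have "AE \<omega> in P. \<forall>x\<in>carrier G. \<forall>s\<in>S. rate \<omega> x s > 0"
    using AE_rate_pos countable_carrier countable_finite[OF S_finite]
    by (intro AE_ball_countable') auto
  with AE_space show ?thesis
    by eventually_elim (simp add: elliptic_def nearest_neighbour_P)
qed

lemma integrable_ln_rate: 
  assumes s: "s \<in> S"
  shows "integrable P (\<lambda>\<omega>. ln (rate \<omega> \<one> s))"
proof (rule integrableI_bounded)
  show "(\<lambda>\<omega>. ln (rate \<omega> \<one> s)) \<in> borel_measurable P"
    using s by simp
  have "(\<integral>\<^sup>+ \<omega>. ennreal (norm (ln (rate \<omega> \<one> s))) \<partial>P) \<le> (\<integral>\<^sup>+ \<omega>. abs_log (pmf (\<omega> \<one>) s) \<partial>P)"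
    using s by (intro nn_integral_mono) (auto simp: abs_log_def)
  then show "(\<integral>\<^sup>+ \<omega>. ennreal (norm (ln (rate \<omega> \<one> s))) \<partial>P) < \<infinity>"
    using log_integrable[OF s] by (rule le_less_trans)
qed

lemma ln_escape_translate:
  assumes x: "x \<in> carrier G" and s: "s \<in> S"
  shows "integrable P (\<lambda>\<omega>. ln (escape n \<omega> x s)) \<longleftrightarrow> integrable P (\<lambda>\<omega>. ln (escape n \<omega> \<one> s))"
    and "(\<integral>\<omega>. ln (escape n \<omega> x s) \<partial>P) = (\<integral>\<omega>. ln (escape n \<omega> \<one> s) \<partial>P)"
proof -
  have "ln (escape n (translate_env G (inv x) \<omega>) \<one> s) = ln (escape n \<omega> x s)" if "\<omega> \<in> space P" for \<omega>
    using escape_translate_env[OF that, of "inv x" \<one> s n] x s by simp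
  from integral_translate[of "inv x" "\<lambda>\<omega>. ln (escape n \<omega> \<one> s)", OF _ _ this]
  show "integrable P (\<lambda>\<omega>. ln (escape n \<omega> x s)) \<longleftrightarrow> integrable P (\<lambda>\<omega>. ln (escape n \<omega> \<one> s))"
    and "(\<integral>\<omega>. ln (escape n \<omega> x s) \<partial>P) = (\<integral>\<omega>. ln (escape n \<omega> \<one> s) \<partial>P)"
    using x s by auto
qed

text \<open>It is possible to climb along a single onward generator \<open>t\<close>, so
  \<open>\<beta>\<^sub>n\<^sub>+\<^sub>1(e, s) \<ge> \<omega>(e, t) \<beta>\<^sub>n(t, t)\<close>, which bounds the logarithm from below.\<close>

lemma integrable_ln_escape:
  assumes "x \<in> carrier G" "s \<in> S"
  shows "integrable P (\<lambda>\<omega>. ln (escape n \<omega> x s))"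
  using assms
proof (induction n arbitrary: x s)
  case (Suc n)
  obtain t where t: "t \<in> onward s" using onward_nonempty[OF Suc.prems(2)] by blast
  have "integrable P (\<lambda>\<omega>. ln (rate \<omega> \<one> t) + ln (escape n \<omega> t t))"
    using t Suc.IH[of t t] by (intro Bochner_Integration.integrable_add integrable_ln_rate) auto
  then have "integrable P (\<lambda>\<omega>. ln (escape (Suc n) \<omega> \<one> s))"
  proof (rule Bochner_Integration.integrable_bound)
    show "(\<lambda>\<omega>. ln (escape (Suc n) \<omega> \<one> s)) \<in> borel_measurable P"
      using measurable_escape_P(1)[of \<one> s "Suc n"] Suc.prems by (intro borel_measurable_ln) auto
    show "AE \<omega> in P. norm (ln (escape (Suc n) \<omega> \<one> s)) \<le> norm (ln (rate \<omega> \<one> t) + ln (escape n \<omega> t t))"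
      using AE_elliptic
    proof eventually_elim
      fix \<omega> assume ell: "elliptic \<omega>"
      let ?A = "\<Sum>t\<in>onward s. rate \<omega> \<one> t * escape n \<omega> (t \<otimes> \<one>) t"
      let ?e = "escape (Suc n) \<omega> \<one> s" and ?a = "rate \<omega> \<one> t * escape n \<omega> (t \<otimes> \<one>) t"
      note A = escape_sum_bounds[OF ell one_closed Suc.prems(2), of n]
      have r: "rate \<omega> \<one> t > 0" using ellipticD(1)[OF ell one_closed] t by auto
      have e: "escape n \<omega> (t \<otimes> \<one>) t > 0" using escape_bounds[OF ell, of "t \<otimes> \<one>" t n] t by auto
      have "?a \<le> ?A"
        using t S_finite by (intro member_le_sum) (auto intro!: mult_nonneg_nonneg escape_nonneg)
      also have "?A \<le> ?e"
        using A ellipticD(2)[OF ell one_closed Suc.prems(2)]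
        by (simp add: escape.simps(2) divide_simps)
      finally have "ln ?a \<le> ln ?e"
        using r e by (intro ln_mono) auto
      moreover have "ln ?e \<le> 0"
        using escape_bounds[OF ell one_closed Suc.prems(2), of "Suc n"] by simp
      moreover have "ln ?a = ln (rate \<omega> \<one> t) + ln (escape n \<omega> t t)"
        using ln_mult_pos[OF r e] t by simp
      ultimately show "norm (ln ?e) \<le> norm (ln (rate \<omega> \<one> t) + ln (escape n \<omega> t t))" by simp
    qed
  qed
  then show ?case by (simp only: ln_escape_translate[OF Suc.prems])
qed simp

lemma ln_one_minus_escape_bounds:
  assumes "elliptic \<omega>" "s \<in> S"
  shows "ln (rate \<omega> \<one> (inv s)) \<le> ln (1 - escape (Suc n) \<omega> \<one> s)" "ln (1 - escape (Suc n) \<omega> \<one> s) \<le> 0"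
proof -
  note q = ellipticD(2)[OF assms(1) one_closed assms(2)]
    one_minus_escape_Suc(2)[OF assms(1) one_closed assms(2), of n]
  show "ln (rate \<omega> \<one> (inv s)) \<le> ln (1 - escape (Suc n) \<omega> \<one> s)"
    by (intro ln_mono) (use q in linarith)+
  show "ln (1 - escape (Suc n) \<omega> \<one> s) \<le> 0"
    using q escape_bounds[OF assms(1) one_closed assms(2), of "Suc n"]
    by (subst ln_le_zero_iff) linarith+
qed

lemma integrable_ln_one_minus_escape:
  assumes s: "s \<in> S"
  shows "integrable P (\<lambda>\<omega>. ln (1 - escape (Suc n) \<omega> \<one> s))"
  using integrable_ln_rate[OF S_inv[OF s]]
proof (rule Bochner_Integration.integrable_bound)
  show "(\<lambda>\<omega>. ln (1 - escape (Suc n) \<omega> \<one> s)) \<in> borel_measurable P"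
    using measurable_escape_P(1)[of \<one> s "Suc n"] s
    by (intro borel_measurable_ln borel_measurable_diff) auto
  show "AE \<omega> in P. norm (ln (1 - escape (Suc n) \<omega> \<one> s)) \<le> norm (ln (rate \<omega> \<one> (inv s)))"
    using AE_elliptic
    by eventually_elim (use ln_one_minus_escape_bounds[OF _ s, of _ n] in fastforce)
qed

text \<open>Passing to the odds \<open>\<beta> / (1 - \<beta>) = A / q\<close> isolates the sum \<open>A\<close>, to which the inequality of the means
  applies.  The term \<open>ln (d - 1)\<close> is the entropy gained by the choice among \<open>d - 1\<close> onward generators.\<close>

lemma ln_escape_odds:
  assumes ell: "elliptic \<omega>" and s: "s \<in> S"
  shows "ln (real (card S - 1)) +
      (\<Sum>t\<in>onward s. ln (rate \<omega> \<one> t) + ln (escape n \<omega> t t)) / real (card S - 1) - ln (rate \<omega> \<one> (inv s))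
    \<le> ln (escape (Suc n) \<omega> \<one> s) - ln (1 - escape (Suc n) \<omega> \<one> s)"
proof -
  let ?A = "\<Sum>t\<in>onward s. rate \<omega> \<one> t * escape n \<omega> (t \<otimes> \<one>) t" and ?q = "rate \<omega> \<one> (inv s)"
  have A: "?A > 0" using escape_sum_bounds(1)[OF ell one_closed s] .
  have q: "?q > 0" using ellipticD(2)[OF ell one_closed s] .
  have c: "card (onward s) = card S - 1" using card_onward[OF s] by simp
  have pos: "rate \<omega> \<one> t > 0" "escape n \<omega> (t \<otimes> \<one>) t > 0" if "t \<in> onward s" for t
    using ellipticD(1)[OF ell one_closed, of t] escape_bounds[OF ell, of "t \<otimes> \<one>" t n] that by auto
  have "(\<Sum>t\<in>onward s. ln (rate \<omega> \<one> t) + ln (escape n \<omega> t t)) =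
      (\<Sum>t\<in>onward s. ln (rate \<omega> \<one> t * escape n \<omega> (t \<otimes> \<one>) t))"
  proof (intro sum.cong refl)
    fix t assume "t \<in> onward s"
    then show "ln (rate \<omega> \<one> t) + ln (escape n \<omega> t t) = ln (rate \<omega> \<one> t * escape n \<omega> (t \<otimes> \<one>) t)"
      using ln_mult_pos[OF pos[of t]] by simp
  qed
  then have mean: "ln (real (card S - 1)) + (\<Sum>t\<in>onward s. ln (rate \<omega> \<one> t) + ln (escape n \<omega> t t)) / real (card S - 1) \<le> ln ?A"
    using ln_sum_ge[of "onward s" "\<lambda>t. rate \<omega> \<one> t * escape n \<omega> (t \<otimes> \<one>) t"]
      S_finite onward_nonempty[OF s] pos by (simp only: c) (simp add: mult_pos_pos)
  have odds: "ln (escape (Suc n) \<omega> \<one> s) - ln (1 - escape (Suc n) \<omega> \<one> s) = ln ?A - ln ?q"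
    unfolding one_minus_escape_Suc(1)[OF ell one_closed s] unfolding escape.simps
    using A q by (simp add: ln_div add_pos_pos del: r_one)
  show ?thesis unfolding odds using mean by (rule diff_right_mono)
qed

text \<open>Stationarity replaces \<open>\<beta>\<^sub>n(t, t)\<close> by \<open>\<beta>\<^sub>n(e, t)\<close> under the expectation, so
  linearity of the expectation suffices.  Averaging over all \<open>s \<in> S\<close> corresponds to the uniform non-backtracking walk, under which
  a generator and its inverse are equally frequent; this is why the drift disappears.\<close>

lemma entropy_bound:
  "real (card S) * ln (real (card S - 1)) \<le> (\<Sum>s\<in>S. \<integral>\<omega>. - ln (1 - escape (Suc n) \<omega> \<one> s) \<partial>P)"
proof -
  let ?c = "real (card S - 1)"
  let ?m = "\<lambda>s. \<integral>\<omega>. ln (rate \<omega> \<one> s) \<partial>P"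
  let ?L = "\<lambda>n s. \<integral>\<omega>. ln (escape n \<omega> \<one> s) \<partial>P"
  let ?D = "\<lambda>s. \<integral>\<omega>. - ln (1 - escape (Suc n) \<omega> \<one> s) \<partial>P"
  have c: "?c > 0" using S_card by simp
  have "ln ?c + (\<Sum>t\<in>onward s. ?m t + ?L n t) / ?c - ?m (inv s) \<le> ?L (Suc n) s + ?D s" if s: "s \<in> S" for s
  proof -
    let ?f = "\<lambda>t \<omega>. ln (rate \<omega> \<one> t) + ln (escape n \<omega> t t)"
    have f: "integrable P (?f t)" "(\<integral>\<omega>. ?f t \<omega> \<partial>P) = ?m t + ?L n t" if "t \<in> onward s" for t
      using that integrable_ln_rate[of t] integrable_ln_escape[of t t n] ln_escape_translate(2)[of t t n] by auto
    note affine = expectation_affine_sum[where A="onward s" and f="?f" and g="\<lambda>\<omega>. ln (rate \<omega> \<one> (inv s))"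
        and a="ln ?c" and c="?c", OF f(1) integrable_ln_rate[OF S_inv[OF s]]]
    have "(\<integral>\<omega>. ln ?c + (\<Sum>t\<in>onward s. ln (rate \<omega> \<one> t) + ln (escape n \<omega> t t)) / ?c - ln (rate \<omega> \<one> (inv s)) \<partial>P)
      \<le> (\<integral>\<omega>. ln (escape (Suc n) \<omega> \<one> s) - ln (1 - escape (Suc n) \<omega> \<one> s) \<partial>P)"
    proof (rule integral_mono_AE)
      show "AE \<omega> in P. ln ?c + (\<Sum>t\<in>onward s. ln (rate \<omega> \<one> t) + ln (escape n \<omega> t t)) / ?c - ln (rate \<omega> \<one> (inv s))
        \<le> ln (escape (Suc n) \<omega> \<one> s) - ln (1 - escape (Suc n) \<omega> \<one> s)"
        using AE_elliptic by eventually_elim (rule ln_escape_odds[OF _ s])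
      show "integrable P (\<lambda>\<omega>. ln ?c + (\<Sum>t\<in>onward s. ln (rate \<omega> \<one> t) + ln (escape n \<omega> t t)) / ?c - ln (rate \<omega> \<one> (inv s)))"
        by (rule affine(1))
      show "integrable P (\<lambda>\<omega>. ln (escape (Suc n) \<omega> \<one> s) - ln (1 - escape (Suc n) \<omega> \<one> s))"
        using s by (intro Bochner_Integration.integrable_diff integrable_ln_escape integrable_ln_one_minus_escape) auto
    qed
    also have "\<dots> = ?L (Suc n) s + ?D s"
      using integrable_ln_escape[OF one_closed s, of "Suc n"] integrable_ln_one_minus_escape[OF s, of n]
      by simp
    also have "(\<integral>\<omega>. ln ?c + (\<Sum>t\<in>onward s. ln (rate \<omega> \<one> t) + ln (escape n \<omega> t t)) / ?c - ln (rate \<omega> \<one> (inv s)) \<partial>P)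
       = ln ?c + (\<Sum>t\<in>onward s. (\<integral>\<omega>. ?f t \<omega> \<partial>P)) / ?c - ?m (inv s)"
      by (rule affine(2))
    also have "(\<Sum>t\<in>onward s. (\<integral>\<omega>. ?f t \<omega> \<partial>P)) = (\<Sum>t\<in>onward s. ?m t + ?L n t)"
      by (rule sum.cong[OF refl f(2)])
    finally show ?thesis .
  qed
  then have "(\<Sum>s\<in>S. ln ?c + (\<Sum>t\<in>onward s. ?m t + ?L n t) / ?c - ?m (inv s)) \<le> (\<Sum>s\<in>S. ?L (Suc n) s + ?D s)"
    by (rule sum_mono)
  also have "(\<Sum>s\<in>S. ln ?c + (\<Sum>t\<in>onward s. ?m t + ?L n t) / ?c - ?m (inv s)) =
      real (card S) * ln ?c + (\<Sum>s\<in>S. \<Sum>t\<in>onward s. ?m t + ?L n t) / ?c - (\<Sum>s\<in>S. ?m (inv s))"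
    by (simp only: sum.distrib sum_subtractf sum_divide_distrib[symmetric] sum_constant)
  also have "(\<Sum>s\<in>S. \<Sum>t\<in>onward s. ?m t + ?L n t) / ?c = (\<Sum>s\<in>S. ?m s) + (\<Sum>s\<in>S. ?L n s)"
    unfolding sum_sum_onward using c by (simp only: sum.distrib) simp
  (* The cancellation of the drift. *)
  also have "(\<Sum>s\<in>S. ?m (inv s)) = (\<Sum>s\<in>S. ?m s)"
    by (rule sum.reindex_bij_witness[of _ "\<lambda>s. inv s" "\<lambda>s. inv s"]) (auto simp: S_inv)
  also have "(\<Sum>s\<in>S. ?L (Suc n) s + ?D s) = (\<Sum>s\<in>S. ?L (Suc n) s) + (\<Sum>s\<in>S. ?D s)"
    by (rule sum.distrib)
  finally have "real (card S) * ln ?c + (\<Sum>s\<in>S. ?L n s) \<le> (\<Sum>s\<in>S. ?L (Suc n) s) + (\<Sum>s\<in>S. ?D s)" by linarith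
  moreover have "(\<Sum>s\<in>S. ?L (Suc n) s) \<le> (\<Sum>s\<in>S. ?L n s)"
  proof (intro sum_mono integral_mono_AE integrable_ln_escape one_closed)
    fix s assume s: "s \<in> S"
    show "AE \<omega> in P. ln (escape (Suc n) \<omega> \<one> s) \<le> ln (escape n \<omega> \<one> s)"
      using AE_elliptic
    proof eventually_elim
      fix \<omega> assume ell: "elliptic \<omega>"
      show "ln (escape (Suc n) \<omega> \<one> s) \<le> ln (escape n \<omega> \<one> s)"
        using escape_bounds[OF ell one_closed s, of "Suc n"] escape_decreasing[OF ell one_closed s, of n]
        by (intro ln_mono) linarith+
    qed
  qed
  ultimately show ?thesis by linarith
qed

text \<open>Otherwise \<open>-ln (1 - \<beta>\<^sub>n(e, s))\<close> would tend to 0 almost surely, dominated by \<open>-ln \<omega>(e, s\<^sup>-\<^sup>1)\<close>, against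
  the uniform lower bound on its expectation.\<close>

lemma escape_inf_not_AE_0: "\<exists>s\<in>S. \<not> (AE \<omega> in P. escape_inf \<omega> \<one> s = 0)"
proof (rule ccontr)
  assume "\<not> ?thesis"
  then have zero: "AE \<omega> in P. escape_inf \<omega> \<one> s = 0" if "s \<in> S" for s using that by blast
  have "(\<lambda>n. \<integral>\<omega>. - ln (1 - escape (Suc n) \<omega> \<one> s) \<partial>P) \<longlonglongrightarrow> (\<integral>\<omega>. 0 \<partial>P)" if s: "s \<in> S" for s
  proof (rule integral_dominated_convergence)
    show "integrable P (\<lambda>\<omega>. - ln (rate \<omega> \<one> (inv s)))"
      using integrable_ln_rate[OF S_inv[OF s]] by simp
    show "(\<lambda>\<omega>. - ln (1 - escape (Suc n) \<omega> \<one> s)) \<in> borel_measurable P" for n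
      using integrable_ln_one_minus_escape[OF s, of n] by (intro borel_measurable_uminus) (rule borel_measurable_integrable)
    show "AE \<omega> in P. norm (- ln (1 - escape (Suc n) \<omega> \<one> s)) \<le> - ln (rate \<omega> \<one> (inv s))" for n
      using AE_elliptic
      by eventually_elim (use ln_one_minus_escape_bounds[OF _ s, of _ n] in fastforce)
    show "AE \<omega> in P. (\<lambda>n. - ln (1 - escape (Suc n) \<omega> \<one> s)) \<longlonglongrightarrow> 0"
      using AE_elliptic zero[OF s]
    proof eventually_elim
      fix \<omega> assume "elliptic \<omega>" "escape_inf \<omega> \<one> s = 0"
      then have "(\<lambda>n. escape (Suc n) \<omega> \<one> s) \<longlonglongrightarrow> 0"
        using LIMSEQ_Suc[OF escape_tendsto[OF _ one_closed s]] by metis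
      then have "(\<lambda>n. - ln (1 - escape (Suc n) \<omega> \<one> s)) \<longlonglongrightarrow> - ln (1 - 0)"
        by (intro tendsto_intros) auto
      then show "(\<lambda>n. - ln (1 - escape (Suc n) \<omega> \<one> s)) \<longlonglongrightarrow> 0" by simp
    qed
  qed simp
  then have "(\<lambda>n. \<Sum>s\<in>S. \<integral>\<omega>. - ln (1 - escape (Suc n) \<omega> \<one> s) \<partial>P) \<longlonglongrightarrow> (\<Sum>s\<in>S. \<integral>\<omega>. 0 \<partial>P)"
    by (rule tendsto_sum)
  then have "real (card S) * ln (real (card S - 1)) \<le> (\<Sum>s\<in>S. \<integral>\<omega>. 0 \<partial>P)"
    by (rule LIMSEQ_le_const) (use entropy_bound in blast)
  moreover have "0 < real (card S) * ln (real (card S - 1))"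
    using S_card by (intro mult_pos_pos) auto
  ultimately show False by simp
qed

end


section \<open>The zero-one law and transience\<close>

context tree_gen_group
begin

text \<open>If all \<open>q\<^sub>t\<close> are positive, then \<open>\<Sum>t. ln q\<^sub>t\<close> equals \<open>d - 1 \<ge> 2\<close> times itself and so is 0, which
  forces \<open>q = 1\<close>.  If some \<open>q\<^sub>t\<close> is 0, then so are all others but possibly \<open>q\<close> at \<open>t\<^sup>-\<^sup>1\<close>, and a third
  generator transfers the zero to \<open>t\<^sup>-\<^sup>1\<close>.\<close>

lemma product_fixed_point_eq_0:
  fixes q :: "'g \<Rightarrow> real"
  assumes q: "\<And>s. s \<in> S \<Longrightarrow> 0 \<le> q s" "\<And>s. s \<in> S \<Longrightarrow> q s \<le> 1"
    and recursion: "\<And>s. s \<in> S \<Longrightarrow> q s = (\<Prod>t\<in>onward s. q t)"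
    and s0: "s0 \<in> S" "q s0 < 1"
    and s: "s \<in> S"
  shows "q s = 0"
proof -
  have vanish: "q s = 0" if "s \<in> S" "t \<in> onward s" "q t = 0" for s t
    using recursion[OF that(1)] that S_finite by (metis finite_Diff prod_zero)
  have "\<exists>t\<in>S. q t = 0"
  proof (rule ccontr)
    assume "\<not> ?thesis"
    then have pos: "q t > 0" if "t \<in> S" for t using q(1)[OF that] that by (auto simp: less_le)
    have nonzero: "q t \<noteq> 0" if "t \<in> S" for t using pos[OF that] by simp
    have "ln (q s) = (\<Sum>t\<in>onward s. ln (q t))" if "s \<in> S" for s
      by (subst recursion[OF that]) (rule ln_prod, use S_finite pos nonzero in auto)
    then have "(\<Sum>s\<in>S. ln (q s)) = (\<Sum>s\<in>S. \<Sum>t\<in>onward s. ln (q t))"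
      by (rule sum.cong[OF refl])
    also have "\<dots> = real (card S - 1) * (\<Sum>s\<in>S. ln (q s))"
      by (rule sum_sum_onward)
    finally have "(\<Sum>s\<in>S. ln (q s)) = real (card S - 1) * (\<Sum>s\<in>S. ln (q s))" .
    moreover have "(\<Sum>s\<in>S. ln (q s)) < 0"
    proof -
      have "(\<Sum>s\<in>S. ln (q s)) < (\<Sum>s\<in>S. 0)"
        using S_finite s0 pos q(2) by (intro sum_strict_mono_ex1) (auto intro!: bexI[of _ s0])
      then show ?thesis by simp
    qed
    ultimately show False using S_card by simp
  qed
  then obtain t where t: "t \<in> S" "q t = 0" by blast
  show "q s = 0"
  proof (cases "t \<in> onward s")
    case True
    then show ?thesis using vanish[OF s] t by blast
  next
    case False
    then have st: "t = inv s" "s = inv t" using t s by auto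
    have "\<not> S \<subseteq> {t, inv t}"
      using S_card card_mono[of "{t, inv t}" S] by (auto simp: card_insert_if split: if_splits)
    then obtain u where u: "u \<in> S" "u \<noteq> t" "u \<noteq> inv t" by blast
    have "t \<noteq> inv u" using u t by auto
    then have "q u = 0" using vanish[OF u(1), of t] t by auto
    moreover have "u \<in> onward s" using u by (simp add: st(1)[symmetric])
    ultimately show ?thesis using vanish[OF s] by blast
  qed
qed

end

context log_integrable_environment
begin

lemma escape_events [measurable]:
  assumes "x \<in> carrier G" "s \<in> S"
  shows "{\<omega> \<in> space P. escape_inf \<omega> x s = 0} \<in> events"
  using measurable_escape_P(2)[OF assms] by measurable

lemma prob_escape_inf_0_translate:
  assumes x: "x \<in> carrier G" and s: "s \<in> S"
  shows "\<P>(\<omega> in P. escape_inf \<omega> x s = 0) = \<P>(\<omega> in P. escape_inf \<omega> \<one> s = 0)"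
proof -
  have A: "{\<omega> \<in> space P. escape_inf \<omega> \<one> s = 0} \<in> sets (env_space G T)"
    using escape_events[OF one_closed s] unfolding sets_P env_space_def .
  have "\<P>(\<omega> in P. escape_inf \<omega> \<one> s = 0) =
      measure (distr P (env_space G T) (translate_env G (inv x))) {\<omega> \<in> space P. escape_inf \<omega> \<one> s = 0}"
    using x by (simp add: distr_translate_env)
  also have "\<dots> = prob (translate_env G (inv x) -` {\<omega> \<in> space P. escape_inf \<omega> \<one> s = 0} \<inter> space P)"
    using x A by (intro measure_distr measurable_translate_env) auto
  also have "translate_env G (inv x) -` {\<omega> \<in> space P. escape_inf \<omega> \<one> s = 0} \<inter> space P =
      {\<omega> \<in> space P. escape_inf \<omega> x s = 0}"
  proof -
    have "translate_env G (inv x) \<omega> \<in> space P" if "\<omega> \<in> space P" for \<omega>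
      using measurable_space[OF measurable_translate_env[of "inv x"] that] x
      by (simp add: env_space_def sets_eq_imp_space_eq[OF sets_P])
    then show ?thesis
      using x s escape_inf_translate_env[of _ "inv x" \<one> s] by auto
  qed
  finally show ?thesis by simp
qed

lemma onward_closed_subtree: "onward_closed ((\<lambda>x. (x, first x)) ` subtree t)"
proof -
  have "(u \<otimes> x, u) \<in> (\<lambda>x. (x, first x)) ` subtree t" if "x \<in> subtree t" "u \<in> onward (first x)" for x u
  proof -
    have "first (u \<otimes> x) = u" using that by (intro first_mult) (auto simp: subtree_def)
    then show ?thesis by (intro image_eqI[OF _ mult_in_subtree[OF that]]) simp
  qed
  then show ?thesis
    by (auto simp: onward_closed_def first_in_S subtree_def simp del: Diff_iff)
qed

text \<open>The escape probability at \<open>t\<close> is a function of the environment in the subtree above \<open>t\<close>, and the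
  subtrees above different neighbours of the root are disjoint.\<close>

lemma escape_inf_indep:
  assumes A: "A \<subseteq> S" "A \<noteq> {}"
  shows "\<P>(\<omega> in P. \<forall>t\<in>A. escape_inf \<omega> t t = 0) = (\<Prod>t\<in>A. \<P>(\<omega> in P. escape_inf \<omega> t t = 0))"
proof -
  have in_K: "(t, t) \<in> (\<lambda>x. (x, first x)) ` subtree t" if "t \<in> S" for t
    by (intro image_eqI[OF _ gen_in_subtree[OF that]]) (simp add: first_gen[OF that])
  have sub: "subtree t \<subseteq> carrier G" for t by (auto simp: subtree_def)
  have "indep_vars (\<lambda>t. PiM (subtree t) (laws_at G T)) (\<lambda>t \<omega>. restrict (\<lambda>x. \<omega> x) (subtree t)) S"
    using iid sub disjoint_subtrees by (intro indep_vars_restrict) (auto simp: iid_environment_def)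
  moreover have "(\<lambda>\<omega>. escape_inf \<omega> t t) \<in> borel_measurable (PiM (subtree t) (laws_at G T))" if "t \<in> S" for t
    by (rule measurable_escape_inf[OF onward_closed_subtree _ sub in_K[OF that]]) auto
  ultimately have "indep_vars (\<lambda>_. borel) (\<lambda>t \<omega>. escape_inf (restrict \<omega> (subtree t)) t t) S"
    by (rule indep_vars_compose2[where Y="\<lambda>t \<omega>. escape_inf \<omega> t t"])
  moreover have local: "escape_inf (restrict \<omega> (subtree t)) t t = escape_inf \<omega> t t" if "t \<in> S" for \<omega> t
  proof -
    have "escape n (restrict \<omega> (subtree t)) t t = escape n \<omega> t t" for n
      using in_K[OF that] by (intro escape_local[OF onward_closed_subtree, where J="subtree t"]) auto
    then show ?thesis by (simp add: escape_inf_def)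
  qed
  ultimately have "prob (\<Inter>t\<in>A. (\<lambda>\<omega>. escape_inf (restrict \<omega> (subtree t)) t t) -` {0} \<inter> space P) =
      (\<Prod>t\<in>A. prob ((\<lambda>\<omega>. escape_inf (restrict \<omega> (subtree t)) t t) -` {0} \<inter> space P))"
    using A S_finite by (intro indep_varsD) (auto intro: finite_subset)
  moreover have "(\<lambda>\<omega>. escape_inf (restrict \<omega> (subtree t)) t t) -` {0} \<inter> space P = {\<omega> \<in> space P. escape_inf \<omega> t t = 0}"
    if "t \<in> A" for t using local[of t] that A by auto
  moreover have "(\<Inter>t\<in>A. {\<omega> \<in> space P. escape_inf \<omega> t t = 0}) = {\<omega> \<in> space P. \<forall>t\<in>A. escape_inf \<omega> t t = 0}"
    using A by auto
  ultimately show ?thesis by simp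
qed

lemma prob_escape_inf_0_recursion:
  assumes s: "s \<in> S"
  shows "\<P>(\<omega> in P. escape_inf \<omega> \<one> s = 0) = (\<Prod>t\<in>onward s. \<P>(\<omega> in P. escape_inf \<omega> \<one> t = 0))"
proof -
  have "{\<omega> \<in> space P. \<forall>t\<in>onward s. escape_inf \<omega> t t = 0} \<in> events"
    using S_finite by (intro sets.sets_Collect_finite_All escape_events) auto
  then have "\<P>(\<omega> in P. escape_inf \<omega> \<one> s = 0) = \<P>(\<omega> in P. \<forall>t\<in>onward s. escape_inf \<omega> t t = 0)"
  proof (intro finite_measure_eq_AE escape_events one_closed s)
    show "AE \<omega> in P. \<omega> \<in> {\<omega> \<in> space P. escape_inf \<omega> \<one> s = 0} \<longleftrightarrow>
        \<omega> \<in> {\<omega> \<in> space P. \<forall>t\<in>onward s. escape_inf \<omega> t t = 0}"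
      using AE_elliptic
    proof eventually_elim
      fix \<omega> assume "elliptic \<omega>"
      from escape_inf_eq_0_iff[OF this one_closed s]
      show "\<omega> \<in> {\<omega> \<in> space P. escape_inf \<omega> \<one> s = 0} \<longleftrightarrow>
        \<omega> \<in> {\<omega> \<in> space P. \<forall>t\<in>onward s. escape_inf \<omega> t t = 0}" by simp
    qed
  qed
  also have "\<dots> = (\<Prod>t\<in>onward s. \<P>(\<omega> in P. escape_inf \<omega> t t = 0))"
    using onward_nonempty[OF s] by (intro escape_inf_indep) auto
  also have "\<dots> = (\<Prod>t\<in>onward s. \<P>(\<omega> in P. escape_inf \<omega> \<one> t = 0))"
    by (intro prod.cong refl prob_escape_inf_0_translate) auto
  finally show ?thesis .
qed

lemma prob_escape_inf_0:
  assumes x: "x \<in> carrier G" and s: "s \<in> S"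
  shows "\<P>(\<omega> in P. escape_inf \<omega> x s = 0) = 0"
proof -
  obtain s0 where s0: "s0 \<in> S" "\<not> (AE \<omega> in P. escape_inf \<omega> \<one> s0 = 0)"
    using escape_inf_not_AE_0 by blast
  have "\<P>(\<omega> in P. escape_inf \<omega> \<one> s0 = 0) \<noteq> 1"
    using prob_Collect_eq_1[OF escape_events[OF one_closed s0(1)]] s0(2) by simp
  then have "\<P>(\<omega> in P. escape_inf \<omega> \<one> s0 = 0) < 1"
    using prob_le_1 by (simp add: less_le)
  then have "\<P>(\<omega> in P. escape_inf \<omega> \<one> s = 0) = 0"
    by (intro product_fixed_point_eq_0[of "\<lambda>s. \<P>(\<omega> in P. escape_inf \<omega> \<one> s = 0)", OF _ _ prob_escape_inf_0_recursion s0(1) _ s])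
       auto
  then show ?thesis by (simp add: prob_escape_inf_0_translate[OF x s])
qed

lemma AE_escape_inf_pos: "AE \<omega> in P. \<forall>x\<in>carrier G. \<forall>s\<in>S. escape_inf \<omega> x s > 0"
proof (intro AE_ball_countable' countable_carrier countable_finite[OF S_finite])
  fix x s assume xs: "x \<in> carrier G" "s \<in> S"
  have "AE \<omega> in P. \<omega> \<notin> {\<omega> \<in> space P. escape_inf \<omega> x s = 0}"
    using prob_escape_inf_0[OF xs] prob_eq_0[OF escape_events[OF xs]] by simp
  with AE_elliptic AE_space show "AE \<omega> in P. escape_inf \<omega> x s > 0"
  proof eventually_elim
    fix \<omega> assume "elliptic \<omega>" "\<omega> \<in> space P" "\<omega> \<notin> {\<omega> \<in> space P. escape_inf \<omega> x s = 0}"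
    then show "escape_inf \<omega> x s > 0" using escape_inf_bounds(1)[OF _ xs, of \<omega>] by auto
  qed
qed

theorem quenched_transient:
  "AE \<omega> in P. AE X in quenched G \<omega> \<one>. filterlim (\<lambda>n. root_dist G S (X n)) at_top sequentially"
  using AE_elliptic AE_escape_inf_pos by eventually_elim (rule transient_if_escape_inf_pos, auto)

theorem annealed_transient:
  "\<P>((\<omega>, X) in annealed G P \<one>. filterlim (\<lambda>n. root_dist G S (X n)) at_top sequentially) = 1"
proof -
  let ?N = "P \<Otimes>\<^sub>M path_space G"
  let ?E = "\<lambda>z. filterlim (\<lambda>n. root_dist G S (snd z n)) at_top sequentially"
  have supp: "set_pmf (\<omega> x) \<subseteq> carrier G" if "\<omega> \<in> space P" "x \<in> carrier G" for \<omega> x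
    by (rule nearest_neighbourD[OF nearest_neighbour_P[OF that(1)] that(2)])
  have Q: "(\<lambda>\<omega>. quenched G \<omega> \<one>) \<in> P \<rightarrow>\<^sub>M subprob_algebra (path_space G)"
    by (intro measurable_quenched countable_carrier one_closed supp measurable_transition_P)
  have walk: "walk_in_environment G \<omega> \<one>" if "\<omega> \<in> space P" for \<omega>
    using supp[OF that] by unfold_locales auto
  note sets_Q = walk_in_environment.sets_quenched[OF walk]
  have [measurable]: "(\<lambda>X. (\<omega>, X)) \<in> quenched G \<omega> \<one> \<rightarrow>\<^sub>M ?N" if "\<omega> \<in> space P" for \<omega>
    unfolding measurable_cong_sets[OF sets_Q[OF that] refl] using that by measurable
  let ?K = "\<lambda>\<omega>. quenched G \<omega> \<one> \<bind> (\<lambda>X. return ?N (\<omega>, X))"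
  have K: "?K \<in> P \<rightarrow>\<^sub>M subprob_algebra ?N"
    by (rule measurable_bind[OF Q]) (simp add: return_measurable)
  have K_distr: "?K \<omega> = distr (quenched G \<omega> \<one>) ?N (\<lambda>X. (\<omega>, X))" if "\<omega> \<in> space P" for \<omega>
    using that prob_space.not_empty[OF walk_in_environment.prob_space_quenched[OF walk[OF that]]]
    by (intro bind_return_distr') auto
  have coordinate: "(\<lambda>z. snd z n) \<in> ?N \<rightarrow>\<^sub>M count_space (carrier G)" for n
    unfolding path_space_def by (intro measurable_compose[OF measurable_snd measurable_component_singleton]) simp
  have "(\<lambda>z. root_dist G S (snd z n)) \<in> ?N \<rightarrow>\<^sub>M count_space UNIV" for n
    by (rule measurable_compose[OF coordinate]) simp
  then have E [measurable]: "Measurable.pred ?N ?E"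
    unfolding filterlim_at_top eventually_sequentially by measurable
  interpret A: prob_space "annealed G P \<one>"
    unfolding annealed_def
  proof (rule prob_space_bind[OF _ K], rule AE_I2)
    fix \<omega> assume \<omega>: "\<omega> \<in> space P"
    show "prob_space (?K \<omega>)"
      unfolding K_distr[OF \<omega>] using \<omega>
      by (intro prob_space.prob_space_distr walk_in_environment.prob_space_quenched walk) auto
  qed
  have "AE z in annealed G P \<one>. ?E z"
    unfolding annealed_def AE_bind[OF K E]
    using quenched_transient AE_space
  proof eventually_elim
    fix \<omega> assume \<omega>: "\<omega> \<in> space P"
      and AE: "AE X in quenched G \<omega> \<one>. filterlim (\<lambda>n. root_dist G S (X n)) at_top sequentially"
    show "AE z in ?K \<omega>. ?E z"
      unfolding K_distr[OF \<omega>] using \<omega> AE predE[OF E] by (subst AE_distr_iff) auto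
  qed
  moreover have sets: "sets (annealed G P \<one>) = sets ?N"
    unfolding annealed_def by (rule sets_bind[OF _ not_empty]) (simp only: K_distr sets_distr)
  moreover have "{z \<in> space (annealed G P \<one>). ?E z} \<in> A.events"
    using predE[OF E] by (simp add: sets sets_eq_imp_space_eq[OF sets])
  ultimately have "A.prob {z \<in> space (annealed G P \<one>). ?E z} = 1"
    using A.prob_Collect_eq_1 by blast
  then show ?thesis by (simp add: split_beta')
qed

end


theorem theorem1:
  fixes k r :: nat
    and T :: "vertex pmf topology"
    and P :: "(vertex \<Rightarrow> vertex pmf) measure"
  assumes "k + r \<ge> 2" and "2 * k + r \<ge> 3"
    and "law_space (tree_gens k r) T"
    and "env_distribution (tree_group k r) T P"
    and "iid_environment (tree_group k r) T P"
    and "\<forall>s\<in>tree_gens k r. (\<integral>\<^sup>+\<omega>. abs_log (pmf (\<omega> \<one>\<^bsub>tree_group k r\<^esub>) s) \<partial>P) < \<infinity>"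
  shows "\<P>((\<omega>, X) in annealed (tree_group k r) P \<one>\<^bsub>tree_group k r\<^esub>.
      filterlim (\<lambda>n. root_dist (tree_group k r) (tree_gens k r) (X n)) at_top sequentially) = 1"
proof -
  interpret tree_gen_group "tree_group k r" "tree_gens k r" word_len word_first
    using assms(2) by (rule tree_gen_group_tree_group)
  interpret log_integrable_environment "tree_group k r" "tree_gens k r" word_len word_first T P
    using assms(3-6) by unfold_locales auto
  show ?thesis by (rule annealed_transient)
qed

end
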